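(* Let $\lambda=(\lambda_1,\ldots,\lambda_r)$ be a partition with $r=\ell(\lambda)$ (positive) parts and let $\lambda'=(\lambda'_1,\ldots,\lambda'_s)$, $s=\lambda_1$, be its conjugate. Let $\boldsymbol{s}=(s_{ij})\in W^{\mathrm{diag}}_{\lambda}$ and write $a_k=s_{i,i+k}$ for $k\in\mathbb{Z}$ (for any $i$ with $(i,i+k)\in D(\lambda)$). (1) Assume further that $\Re(s_{i,\lambda_i})>1$ for all $1\le i\le r$. Then $$\zeta_{\lambda}(\boldsymbol{s})=\det\left[\zeta^{\star}(a_{-j+1},a_{-j+2},\ldots,a_{-j+(\lambda_i-i+j)})\right]_{1\le i,j\le r},$$ where the $(i,j)$ entry is understood to be $1$ if $\lambda_i-i+j=0$ and $0$ if $\lambda_i-i+j<0$. (2) Assume further that $\Re(s_{\lambda'_i,i})>1$ for all $1\le i\le s$. Then $$\zeta_{\lambda}(\boldsymbol{s})=\det\left[\zeta(a_{j-1},a_{j-2},\ldots,a_{j-(\lambda'_i-i+j)})\right]_{1\le i,j\le s},$$ where the $(i,j)$ entry is understood to be $1$ if $\lambda'_i-i+j=0$ and $0$ if $\lambda'_i-i+j<0$.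
   Context: $\mathbb{N}$ denotes the positive integers. For complex numbers, $\zeta(s_1,\ldots,s_n)=\sum_{0<m_1<\cdots<m_n}\prod_i m_i^{-s_i}$ and $\zeta^{\star}(s_1,\ldots,s_n)=\sum_{0<m_1\le\cdots\le m_n}\prod_i m_i^{-s_i}$ (sums over positive integers); they converge absolutely if $\Re(s_1),\ldots,\Re(s_{n-1})\ge1$ and $\Re(s_n)>1$. A partition $\lambda=(\lambda_1\ge\cdots\ge\lambda_r>0)$ has Young diagram $D(\lambda)=\{(i,j):1\le i\le r,\ 1\le j\le\lambda_i\}$; its conjugate is $\lambda'_i=\#\{j:\lambda_j\ge i\}$. A corner of $\lambda$ is $(i,j)\in D(\lambda)$ with $(i+1,j)\notin D(\lambda)$ and $(i,j+1)\notin D(\lambda)$; $C(\lambda)$ is the set of corners. For a set $X$, $T(\lambda,X)$ is the set of fillings $(t_{ij})_{(i,j)\in D(\lambda)}$ with $t_{ij}\in X$, and $T^{\mathrm{diag}}(\lambda,X)$ is the subset of those with $t_{ij}=t_{kl}$ whenever $j-i=l-k$. $\mathrm{SSYT}(\lambda)\subset T(\lambda,\mathbb{N})$ is the set of semi-standard tableaux (rows weakly increasing left to right, columns strictly increasing top to bottom). For $\boldsymbol{s}=(s_{ij})\in T(\lambda,\mathbb{C})$ the Schur multiple zeta function is $$\zeta_\lambda(\boldsymbol{s})=\sum_{(m_{ij})\in\mathrm{SSYT}(\lambda)}\prod_{(i,j)\in D(\lambda)}m_{ij}^{-s_{ij}}.$$ $W_\lambda$ is the set of $\boldsymbol{s}\in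 T(\lambda,\mathbb{C})$ with $\Re(s_{ij})\ge1$ for all $(i,j)\in D(\lambda)\setminus C(\lambda)$ and $\Re(s_{ij})>1$ for all $(i,j)\in C(\lambda)$; the series converges absolutely there. $W^{\mathrm{diag}}_\lambda=W_\lambda\cap T^{\mathrm{diag}}(\lambda,\mathbb{C})$. *)

theory Defs
  imports
    "HOL-Analysis.Infinite_Sum"
    "HOL-Analysis.Complex_Transcendental"
    "Jordan_Normal_Form.Determinant"
begin

definition is_partition :: "nat list \<Rightarrow> bool" where
  "is_partition lam \<longleftrightarrow> sorted_wrt (\<ge>) lam \<and> (\<forall>x\<in>set lam. 0 < x)"

text \<open>Parts, rows and columns are numbered from 1; parts beyond the length are 0.\<close>

definition part :: "nat list \<Rightarrow> nat \<Rightarrow> nat" where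
  "part lam i = (if 1 \<le> i \<and> i \<le> length lam then lam ! (i - 1) else 0)"

definition conj_part :: "nat list \<Rightarrow> nat \<Rightarrow> nat" where
  "conj_part lam i = card {j. 1 \<le> j \<and> j \<le> length lam \<and> part lam j \<ge> i}"

definition young_diagram :: "nat list \<Rightarrow> (nat \<times> nat) set" where
  "young_diagram lam = {(i, j). 1 \<le> i \<and> i \<le> length lam \<and> 1 \<le> j \<and> j \<le> part lam i}"

definition corners :: "nat list \<Rightarrow> (nat \<times> nat) set" where
  "corners lam = {(i, j). (i, j) \<in> young_diagram lam
      \<and> (i + 1, j) \<notin> young_diagram lam \<and> (i, j + 1) \<notin> young_diagram lam}"

text \<open>Fillings are extensional functions, so that a filling is determined by its entries on
  the diagram and sums over sets of fillings count each one once.\<close>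

definition tableaux :: "nat list \<Rightarrow> 'a set \<Rightarrow> (nat \<times> nat \<Rightarrow> 'a) set" where
  "tableaux lam X = (\<Pi>\<^sub>E p\<in>young_diagram lam. X)"

definition diag_tableaux :: "nat list \<Rightarrow> 'a set \<Rightarrow> (nat \<times> nat \<Rightarrow> 'a) set" where
  "diag_tableaux lam X = {t \<in> tableaux lam X.
     \<forall>i j k l. (i, j) \<in> young_diagram lam \<longrightarrow> (k, l) \<in> young_diagram lam \<longrightarrow>
       int j - int i = int l - int k \<longrightarrow> t (i, j) = t (k, l)}"

definition SSYT :: "nat list \<Rightarrow> (nat \<times> nat \<Rightarrow> nat) set" where
  "SSYT lam = {m \<in> tableaux lam {0<..}.
     (\<forall>i j k. (i, j) \<in> young_diagram lam \<longrightarrow> (i, k) \<in> young_diagram lam \<longrightarrow> j < k \<longrightarrow>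
        m (i, j) \<le> m (i, k)) \<and>
     (\<forall>i j k. (i, k) \<in> young_diagram lam \<longrightarrow> (j, k) \<in> young_diagram lam \<longrightarrow> i < j \<longrightarrow>
        m (i, k) < m (j, k))}"

definition schur_mzeta :: "nat list \<Rightarrow> (nat \<times> nat \<Rightarrow> complex) \<Rightarrow> complex" where
  "schur_mzeta lam s =
     (\<Sum>\<^sub>\<infinity>m\<in>SSYT lam. \<Prod>p\<in>young_diagram lam. of_nat (m p) powr (- s p))"

definition W :: "nat list \<Rightarrow> (nat \<times> nat \<Rightarrow> complex) set" where
  "W lam = {s \<in> tableaux lam UNIV.
     (\<forall>p \<in> young_diagram lam - corners lam. Re (s p) \<ge> 1) \<and>
     (\<forall>p \<in> corners lam. Re (s p) > 1)}"

definition W_diag :: "nat list \<Rightarrow> (nat \<times> nat \<Rightarrow> complex) set" where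
  "W_diag lam = W lam \<inter> diag_tableaux lam UNIV"

definition mzeta :: "complex list \<Rightarrow> complex" where
  "mzeta s = (\<Sum>\<^sub>\<infinity>m | length m = length s \<and> (\<forall>x\<in>set m. 0 < x) \<and> sorted_wrt (<) m.
     \<Prod>i<length s. of_nat (m ! i :: nat) powr (- (s ! i)))"

definition mzeta_star :: "complex list \<Rightarrow> complex" where
  "mzeta_star s = (\<Sum>\<^sub>\<infinity>m | length m = length s \<and> (\<forall>x\<in>set m. 0 < x) \<and> sorted_wrt (\<le>) m.
     \<Prod>i<length s. of_nat (m ! i :: nat) powr (- (s ! i)))"

text \<open>Entries of the two Jacobi-Trudi matrices, with 1-based indices \<open>i\<close> and \<open>j\<close>.\<close>

definition jacobi_trudi_entry :: "nat list \<Rightarrow> (int \<Rightarrow> complex) \<Rightarrow> nat \<Rightarrow> nat \<Rightarrow> complex" where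
  "jacobi_trudi_entry lam a i j =
     (let n = int (part lam i) - int i + int j in
      if n < 0 then 0 else if n = 0 then 1
      else mzeta_star (map (\<lambda>k. a (- int j + k)) [1..n]))"

definition dual_jacobi_trudi_entry :: "nat list \<Rightarrow> (int \<Rightarrow> complex) \<Rightarrow> nat \<Rightarrow> nat \<Rightarrow> complex" where
  "dual_jacobi_trudi_entry lam a i j =
     (let n = int (conj_part lam i) - int i + int j in
      if n < 0 then 0 else if n = 0 then 1
      else mzeta (map (\<lambda>k. a (int j - k)) [1..n]))"

end

theory Submission
  imports Defs
begin

text \<open>Both determinant formulas hold already at the level of polynomials. Restrict all summation
  variables to \<open>{1..N}\<close> and replace \<open>m powr - a c\<close> by an arbitrary weight \<open>w c m\<close> in a commutative
  ring, depending on the content \<open>c\<close> of a cell and on its entry \<open>m\<close>. Then the tableau sum of a shape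
  equals the Jacobi-Trudi determinant of truncated sums over weakly (or strictly) increasing chains,
  and the theorem is the limit \<open>N \<rightarrow> \<infinity>\<close>.

  The finite identity is proved by induction on \<open>N\<close>, comparing how both sides change when the value
  \<open>N + 1\<close> becomes available. For tableaux, the cells with entry \<open>N + 1\<close> form a horizontal strip,
  which gives the branching rule \<open>ssyt_sum_Suc\<close>. For chain sums, splitting off the last entry gives
  the two-term recursion \<open>chain_entry_Suc\<close>. It is the dependence of the weights on the content alone
  that makes the determinant fit: the last exponent in an entry of row \<open>i\<close> is that of the last cell of
  row (or column) \<open>i\<close>, whatever the column of the matrix is, so the recursion acts on whole rows of
  the matrix and the determinant can be expanded by multilinearity.

  For weak chains, subtracting a multiple of row \<open>i + 1\<close> from row \<open>i\<close> turns row \<open>i\<close> into a sum over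
  the lengths between \<open>\<lambda>\<^sub>i\<^sub>+\<^sub>1\<close> and \<open>\<lambda>\<^sub>i\<close>; choosing one length in each row is the same as
  removing a horizontal strip (\<open>bounded_jacobi_trudi_rows\<close>). For strict chains, each row is a sum of two
  terms, according to whether a column loses its lowest cell; the choices that do not yield a shape
  produce two equal rows or a zero row (\<open>bounded_jacobi_trudi_columns\<close>).

  For the limit, every series involved must converge absolutely. Its terms are indexed by fillings
  whose largest entry sits at a cell with an exponent of real part \<open>1 + \<delta>\<close> or more, \<open>\<delta> > 0\<close>.
  Spreading this excess evenly over all cells bounds the series by a product of convergent series
  (\<open>zeta_terms_summable_on\<close>).\<close>

section \<open>The branching rule for semi-standard tableaux\<close>

definition bounded_ssyt :: "(nat \<times> nat) set \<Rightarrow> nat \<Rightarrow> (nat \<times> nat \<Rightarrow> nat) set" where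
  "bounded_ssyt D N = {t \<in> D \<rightarrow>\<^sub>E {1..N}.
     (\<forall>i j k. (i, j) \<in> D \<longrightarrow> (i, k) \<in> D \<longrightarrow> j < k \<longrightarrow> t (i, j) \<le> t (i, k)) \<and>
     (\<forall>i j k. (i, k) \<in> D \<longrightarrow> (j, k) \<in> D \<longrightarrow> i < j \<longrightarrow> t (i, k) < t (j, k))}"

definition ssyt_sum :: "(nat \<times> nat \<Rightarrow> nat \<Rightarrow> 'a::comm_ring_1) \<Rightarrow> (nat \<times> nat) set \<Rightarrow> nat \<Rightarrow> 'a" where
  "ssyt_sum w D N = (\<Sum>t\<in>bounded_ssyt D N. \<Prod>p\<in>D. w p (t p))"

text \<open>In a semi-standard tableau with entries at most \<open>N + 1\<close>, the cells with entry \<open>N + 1\<close> form a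
  horizontal strip; the members of \<open>strips D\<close> are what such strips leave of \<open>D\<close>. A cell to the left
  of a remaining cell remains. The second condition asks more of columns than that: every cell
  above another cell of \<open>D\<close> remains, whether or not the latter does, since the entries of a column
  increase strictly. So a column loses at most its lowest cell.\<close>

definition strips :: "(nat \<times> nat) set \<Rightarrow> (nat \<times> nat) set set" where
  "strips D = {E. E \<subseteq> D \<and>
     (\<forall>i j k. (i, j) \<in> E \<longrightarrow> (i, k) \<in> D \<longrightarrow> k < j \<longrightarrow> (i, k) \<in> E) \<and>
     (\<forall>i j k. (i, k) \<in> D \<longrightarrow> (j, k) \<in> D \<longrightarrow> i < j \<longrightarrow> (i, k) \<in> E)}"

lemma finite_bounded_ssyt: "finite D \<Longrightarrow> finite (bounded_ssyt D N)"
  unfolding bounded_ssyt_def by (rule finite_subset[of _ "D \<rightarrow>\<^sub>E {1..N}"]) (auto intro: finite_PiE)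

lemma ssyt_sum_0: "ssyt_sum w D 0 = (if D = {} then 1 else 0)"
proof (cases "D = {}")
  case True
  then have "bounded_ssyt D 0 = {\<lambda>_. undefined}"
    by (auto simp: bounded_ssyt_def)
  with True show ?thesis by (simp add: ssyt_sum_def)
next
  case False
  then have "bounded_ssyt D 0 = {}"
    by (auto simp: bounded_ssyt_def PiE_eq_empty_iff)
  with False show ?thesis by (simp add: ssyt_sum_def)
qed

text \<open>The branching rule: a tableau is determined by the set \<open>E\<close> of cells with entries at most \<open>N\<close>
  and by its restriction to \<open>E\<close>, and the strip conditions on \<open>E\<close> are exactly what makes
  every semi-standard filling of \<open>E\<close> extend by the constant \<open>N + 1\<close>. The set \<open>D\<close> is arbitrary, so
  the same rule serves for shapes described by their rows and by their columns.\<close>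

lemma ssyt_sum_Suc:
  assumes fin: "finite D"
  shows "ssyt_sum w D (Suc N) = (\<Sum>E\<in>strips D. (\<Prod>p\<in>D - E. w p (Suc N)) * ssyt_sum w E N)"
proof -
  have fS: "finite (strips D)"
    by (rule finite_subset[of _ "Pow D"]) (auto simp: strips_def fin)
  have fE: "finite E" if "E \<in> strips D" for E
    using that fin by (auto simp: strips_def intro: finite_subset)
  define ext where "ext = (\<lambda>(E, u) p. if p \<in> E then u p else if p \<in> D then Suc N else (undefined::nat))"
  define low where "low = (\<lambda>t::nat \<times> nat \<Rightarrow> nat. {p \<in> D. t p \<le> N})"
  have "(\<Sum>E\<in>strips D. (\<Prod>p\<in>D - E. w p (Suc N)) * ssyt_sum w E N)
      = (\<Sum>E\<in>strips D. \<Sum>u\<in>bounded_ssyt E N. (\<Prod>p\<in>D - E. w p (Suc N)) * (\<Prod>p\<in>E. w p (u p)))"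
    by (simp add: ssyt_sum_def sum_distrib_left)
  also have "\<dots> = (\<Sum>(E, u)\<in>Sigma (strips D) (\<lambda>E. bounded_ssyt E N).
                    (\<Prod>p\<in>D - E. w p (Suc N)) * (\<Prod>p\<in>E. w p (u p)))"
    by (rule sum.Sigma) (auto simp: fS fE finite_bounded_ssyt)
  also have "\<dots> = (\<Sum>t\<in>bounded_ssyt D (Suc N). \<Prod>p\<in>D. w p (t p))"
  proof (rule sum.reindex_bij_witness[where i = "\<lambda>t. (low t, restrict t (low t))" and j = ext])
    fix x assume "x \<in> Sigma (strips D) (\<lambda>E. bounded_ssyt E N)"
    then obtain E u where x: "x = (E, u)" and E: "E \<in> strips D" and u: "u \<in> bounded_ssyt E N"
      by auto
    have ED: "E \<subseteq> D" using E by (simp add: strips_def)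
    have uE: "u \<in> E \<rightarrow>\<^sub>E {1..N}" using u by (simp add: bounded_ssyt_def)
    have ule: "u p \<le> N" "1 \<le> u p" if "p \<in> E" for p using PiE_mem[OF uE that] by auto
    have low: "low (ext x) = E"
      using ED ule(1) by (auto simp: low_def ext_def x split: if_splits)
    moreover have "restrict (ext x) E = u"
      using uE by (auto simp: ext_def x restrict_def fun_eq_iff PiE_def extensional_def)
    ultimately show "(low (ext x), restrict (ext x) (low (ext x))) = x"
      by (simp add: x)
    have rowE: "(i, k) \<in> E" if "(i, j) \<in> E" "(i, k) \<in> D" "k < j" for i j k
      using E that unfolding strips_def by blast
    have colE: "(i, k) \<in> E" if "(i, k) \<in> D" "(j, k) \<in> D" "i < j" for i j k
      using E that unfolding strips_def by blast
    have rowu: "u (i, j) \<le> u (i, k)" if "(i, j) \<in> E" "(i, k) \<in> E" "j < k" for i j k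
      using u that by (simp add: bounded_ssyt_def)
    have colu: "u (i, k) < u (j, k)" if "(i, k) \<in> E" "(j, k) \<in> E" "i < j" for i j k
      using u that by (simp add: bounded_ssyt_def)
    show "ext x \<in> bounded_ssyt D (Suc N)"
      unfolding bounded_ssyt_def mem_Collect_eq
    proof (intro conjI allI impI)
      show "ext x \<in> D \<rightarrow>\<^sub>E {1..Suc N}"
        using ED ule by (auto simp: ext_def x PiE_iff extensional_def intro: le_SucI)
      show "ext x (i, j) \<le> ext x (i, k)" if "(i, j) \<in> D" "(i, k) \<in> D" "j < k" for i j k
        using that rowE[of i k j] rowu[of i j k] ule(1) by (auto simp: ext_def x intro: le_SucI)
      show "ext x (i, k) < ext x (j, k)" if "(i, k) \<in> D" "(j, k) \<in> D" "i < j" for i j k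
        using that colE[of i k j] colu[of i k j] ule(1) by (auto simp: ext_def x less_Suc_eq_le)
    qed
    have "(\<Prod>p\<in>D. w p (ext x p)) = (\<Prod>p\<in>D - E. w p (ext x p)) * (\<Prod>p\<in>E. w p (ext x p))"
      using ED fin by (rule prod.subset_diff)
    also have "\<dots> = (\<Prod>p\<in>D - E. w p (Suc N)) * (\<Prod>p\<in>E. w p (u p))"
      by (intro arg_cong2[of _ _ _ _ "(*)"] prod.cong) (auto simp: ext_def x)
    finally show "(\<Prod>p\<in>D. w p (ext x p)) =
        (case x of (E, u) \<Rightarrow> (\<Prod>p\<in>D - E. w p (Suc N)) * (\<Prod>p\<in>E. w p (u p)))"
      by (simp add: x)
  next
    fix t assume "t \<in> bounded_ssyt D (Suc N)"
    then have tD: "t \<in> D \<rightarrow>\<^sub>E {1..Suc N}"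
      and row: "\<And>i j k. (i, j) \<in> D \<Longrightarrow> (i, k) \<in> D \<Longrightarrow> j < k \<Longrightarrow> t (i, j) \<le> t (i, k)"
      and col: "\<And>i j k. (i, k) \<in> D \<Longrightarrow> (j, k) \<in> D \<Longrightarrow> i < j \<Longrightarrow> t (i, k) < t (j, k)"
      by (simp_all add: bounded_ssyt_def)
    have tle: "t p \<le> Suc N" "1 \<le> t p" if "p \<in> D" for p using PiE_mem[OF tD that] by auto
    show "ext (low t, restrict t (low t)) = t"
    proof
      fix p
      show "ext (low t, restrict t (low t)) p = t p"
        using tle(1)[of p] PiE_arb[OF tD, of p]
        by (cases "p \<in> D") (auto simp: ext_def low_def le_Suc_eq)
    qed
    have "low t \<in> strips D"
      unfolding strips_def mem_Collect_eq
    proof (intro conjI allI impI)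
      show "low t \<subseteq> D" by (auto simp: low_def)
      show "(i, k) \<in> low t" if "(i, j) \<in> low t" "(i, k) \<in> D" "k < j" for i j k
        using that row[of i k j] by (auto simp: low_def)
      show "(i, k) \<in> low t" if "(i, k) \<in> D" "(j, k) \<in> D" "i < j" for i j k
        using that col[of i k j] tle(1)[of "(j, k)"] by (auto simp: low_def)
    qed
    moreover have "restrict t (low t) \<in> bounded_ssyt (low t) N"
      using tle row col by (auto simp: bounded_ssyt_def low_def)
    ultimately show "(low t, restrict t (low t)) \<in> Sigma (strips D) (\<lambda>E. bounded_ssyt E N)"
      by simp
  qed
  finally show ?thesis by (simp add: ssyt_sum_def)
qed

section \<open>Truncated sums over chains\<close>

definition chains :: "(nat \<Rightarrow> nat \<Rightarrow> bool) \<Rightarrow> nat \<Rightarrow> nat \<Rightarrow> nat list set" where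
  "chains R n N = {m. length m = n \<and> set m \<subseteq> {1..N} \<and> sorted_wrt R m}"

definition chain_sum ::
  "(nat \<Rightarrow> nat \<Rightarrow> bool) \<Rightarrow> (int \<Rightarrow> nat \<Rightarrow> 'a::comm_ring_1) \<Rightarrow> nat \<Rightarrow> int list \<Rightarrow> 'a" where
  "chain_sum R w N cs = (\<Sum>m\<in>chains R (length cs) N. \<Prod>i<length cs. w (cs ! i) (m ! i))"

text \<open>The entries of both matrices, cut off at \<open>N\<close>. The length \<open>n\<close> is an integer, with the
  convention of the determinant for \<open>n \<le> 0\<close>; the number \<open>f k\<close> is the content attached to
  the \<open>k\<close>-th summation variable.\<close>

definition chain_entry ::
  "(nat \<Rightarrow> nat \<Rightarrow> bool) \<Rightarrow> (int \<Rightarrow> nat \<Rightarrow> 'a::comm_ring_1) \<Rightarrow> nat \<Rightarrow> (int \<Rightarrow> int) \<Rightarrow> int \<Rightarrow> 'a" where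
  "chain_entry R w N f n = (if n < 0 then 0 else chain_sum R w N (map f [1..n]))"

lemma finite_chains: "finite (chains R n N)"
  by (rule finite_subset[OF _ finite_lists_length_eq[of "{1..N}" n]]) (auto simp: chains_def)

lemma chain_sum_Nil: "chain_sum R w N [] = 1"
proof -
  have "chains R 0 N = {[]}" by (auto simp: chains_def)
  then show ?thesis by (simp add: chain_sum_def)
qed

lemma chain_sum_0: "cs \<noteq> [] \<Longrightarrow> chain_sum R w 0 cs = 0"
proof -
  assume "cs \<noteq> []"
  then have "chains R (length cs) 0 = {}" by (auto simp: chains_def)
  then show ?thesis by (simp add: chain_sum_def)
qed

text \<open>Either the last entry of a chain is at most \<open>N\<close>, or it is \<open>N + 1\<close>, and then the other entries
  form a chain bounded by \<open>M\<close>. Here \<open>M\<close> is \<open>N + 1\<close> for weak chains and \<open>N\<close> for strict ones.\<close>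

lemma chain_sum_snoc:
  assumes le: "\<And>x y. R x y \<Longrightarrow> x \<le> y"
    and M: "\<And>x. x \<le> Suc N \<and> R x (Suc N) \<longleftrightarrow> x \<le> M"
  shows "chain_sum R w (Suc N) (cs @ [c]) = chain_sum R w N (cs @ [c]) + w c (Suc N) * chain_sum R w M cs"
proof -
  let ?n = "length cs"
  have "chains R (Suc ?n) (Suc N) = chains R (Suc ?n) N \<union> (\<lambda>m. m @ [Suc N]) ` chains R ?n M"
    (is "?A = ?B \<union> ?C")
  proof (intro Set.equalityI subsetI)
    fix m assume m: "m \<in> ?A"
    then obtain m' x where mx: "m = m' @ [x]"
      by (auto simp: chains_def length_Suc_conv_rev)
    from m have *: "length m' = ?n" "set m' \<subseteq> {1..Suc N}" "x \<in> {1..Suc N}" "sorted_wrt R m'"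
      "\<And>y. y \<in> set m' \<Longrightarrow> R y x"
      by (auto simp: chains_def mx sorted_wrt_append)
    show "m \<in> ?B \<union> ?C"
    proof (cases "x = Suc N")
      case True
      have "y \<le> M" if "y \<in> set m'" for y
        using M[of y] *(2) *(5)[OF that] that True by auto
      then have "m' \<in> chains R ?n M"
        using * by (force simp: chains_def)
      then show ?thesis using True mx by blast
    next
      case False
      then have "x \<le> N" using *(3) by auto
      then have "m \<in> ?B"
        using * le by (force simp: chains_def mx sorted_wrt_append)
      then show ?thesis by blast
    qed
  next
    fix m assume "m \<in> ?B \<union> ?C"
    then show "m \<in> ?A"
    proof
      assume "m \<in> ?B" then show ?thesis by (force simp: chains_def)
    next
      assume "m \<in> ?C"
      then obtain m' where m': "m = m' @ [Suc N]" "m' \<in> chains R ?n M" by blast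
      have "x \<le> Suc N \<and> R x (Suc N)" if "x \<in> set m'" for x
        using m'(2) that M[of x] by (auto simp: chains_def)
      then show ?thesis using m' by (auto simp: chains_def sorted_wrt_append)
    qed
  qed
  moreover have "?B \<inter> ?C = {}" by (auto simp: chains_def)
  moreover have "inj_on (\<lambda>m. m @ [Suc N]) (chains R ?n M)" by (auto simp: inj_on_def)
  ultimately have "chain_sum R w (Suc N) (cs @ [c]) = chain_sum R w N (cs @ [c]) +
     (\<Sum>m\<in>chains R ?n M. \<Prod>i<Suc ?n. w ((cs @ [c]) ! i) ((m @ [Suc N]) ! i))"
    unfolding chain_sum_def
    by (simp del: prod.lessThan_Suc add: sum.union_disjoint finite_chains sum.reindex)
  also have "(\<Sum>m\<in>chains R ?n M. \<Prod>i<Suc ?n. w ((cs @ [c]) ! i) ((m @ [Suc N]) ! i)) =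
      (\<Sum>m\<in>chains R ?n M. w c (Suc N) * (\<Prod>i<?n. w (cs ! i) (m ! i)))"
  proof (rule sum.cong)
    fix m assume "m \<in> chains R ?n M"
    then have "length m = ?n" by (simp add: chains_def)
    then have "((m @ [Suc N]) ! ?n) = Suc N" by (metis nth_append_length)
    with \<open>length m = ?n\<close> show "(\<Prod>i<Suc ?n. w ((cs @ [c]) ! i) ((m @ [Suc N]) ! i))
        = w c (Suc N) * (\<Prod>i<?n. w (cs ! i) (m ! i))"
      by (simp add: nth_append mult.commute)
  qed simp
  finally show ?thesis by (simp add: chain_sum_def sum_distrib_left)
qed

lemma chain_entry_0: "chain_entry R w 0 f n = (if n = 0 then 1 else 0)"
  by (auto simp: chain_entry_def chain_sum_Nil chain_sum_0)

text \<open>The convention for \<open>n \<le> 0\<close> is the one that makes the recursion hold for every integer \<open>n\<close>;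
  this is why the determinants need no separate treatment of their degenerate entries.\<close>

lemma chain_entry_Suc:
  assumes "\<And>x y. R x y \<Longrightarrow> x \<le> y"
    and "\<And>x. x \<le> Suc N \<and> R x (Suc N) \<longleftrightarrow> x \<le> M"
  shows "chain_entry R w (Suc N) f n = chain_entry R w N f n + w (f n) (Suc N) * chain_entry R w M f (n - 1)"
proof (cases "n \<ge> 1")
  case True
  then have "[1..n] = [1..n - 1] @ [n]" by (simp add: upto_rec2)
  with True show ?thesis
    using chain_sum_snoc[where R = R and N = N and M = M, OF assms, of w "map f [1..n-1]" "f n"] by (simp add: chain_entry_def)
next
  case False
  then show ?thesis by (cases "n = 0") (simp_all add: chain_entry_def chain_sum_Nil)
qed

lemma chain_entry_weak_Suc:
  "chain_entry (\<le>) w (Suc N) f n =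
     chain_entry (\<le>) w N f n + w (f n) (Suc N) * chain_entry (\<le>) w (Suc N) f (n - 1)"
  by (rule chain_entry_Suc[where R = "(\<le>)"]) auto

lemma chain_entry_strict_Suc:
  "chain_entry (<) w (Suc N) f n =
     chain_entry (<) w N f n + w (f n) (Suc N) * chain_entry (<) w N f (n - 1)"
  by (rule chain_entry_Suc[where R = "(<)"]) auto

section \<open>Determinants and row operations\<close>

text \<open>The determinant with rows and columns numbered from 1, like the parts of a partition.\<close>

definition det1 :: "nat \<Rightarrow> (nat \<Rightarrow> nat \<Rightarrow> 'a::comm_ring_1) \<Rightarrow> 'a" where
  "det1 n f = Determinant.det (mat n n (\<lambda>(i, j). f (Suc i) (Suc j)))"

lemma det1_cong:
  assumes "\<And>i j. i \<in> {1..n} \<Longrightarrow> j \<in> {1..n} \<Longrightarrow> f i j = g i j"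
  shows "det1 n f = det1 n g"
  unfolding det1_def by (intro arg_cong[of _ _ Determinant.det] eq_matI) (auto simp: assms)

lemma det1_Leibniz:
  "det1 n f = (\<Sum>p | p permutes {0..<n}. signof p * (\<Prod>i\<in>{1..n}. f i (Suc (p (i - 1)))))"
proof -
  have "(\<Prod>i = 0..<n. mat n n (\<lambda>(i, j). f (Suc i) (Suc j)) $$ (i, p i)) =
        (\<Prod>i\<in>{1..n}. f i (Suc (p (i - 1))))" if "p permutes {0..<n}" for p
  proof (rule prod.reindex_bij_witness[where i = "\<lambda>i. i - 1" and j = Suc], goal_cases)
    case (5 i)
    then have "p i < n" using permutes_in_image[OF that, of i] by auto
    with 5 show ?case by simp
  qed auto
  then show ?thesis
    unfolding det1_def by (simp add: Determinant.det_def)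
qed

text \<open>Multilinearity in all rows at once: choosing one summand \<open>\<kappa> i\<close> from every row \<open>i\<close>.\<close>

lemma det1_expand_rows:
  fixes c :: "nat \<Rightarrow> 'k \<Rightarrow> 'a::comm_ring_1"
  assumes "\<And>i. i \<in> {1..n} \<Longrightarrow> finite (K i)"
  shows "det1 n (\<lambda>i j. \<Sum>k\<in>K i. c i k * g i k j) =
         (\<Sum>\<kappa>\<in>Pi\<^sub>E {1..n} K. (\<Prod>i\<in>{1..n}. c i (\<kappa> i)) * det1 n (\<lambda>i j. g i (\<kappa> i) j))"
proof -
  have "det1 n (\<lambda>i j. \<Sum>k\<in>K i. c i k * g i k j) = (\<Sum>p | p permutes {0..<n}. signof p *
      (\<Sum>\<kappa>\<in>Pi\<^sub>E {1..n} K. \<Prod>i\<in>{1..n}. c i (\<kappa> i) * g i (\<kappa> i) (Suc (p (i - 1)))))"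
    unfolding det1_Leibniz by (subst prod_sum_PiE) (auto simp: assms)
  also have "\<dots> = (\<Sum>\<kappa>\<in>Pi\<^sub>E {1..n} K. \<Sum>p | p permutes {0..<n}.
      (\<Prod>i\<in>{1..n}. c i (\<kappa> i)) * (signof p * (\<Prod>i\<in>{1..n}. g i (\<kappa> i) (Suc (p (i - 1))))))"
    by (subst sum.swap) (simp add: sum_distrib_left prod.distrib mult.left_commute)
  finally show ?thesis by (simp add: det1_Leibniz sum_distrib_left)
qed

lemma det1_zero_row:
  assumes "i \<in> {1..n}" "\<And>j. j \<in> {1..n} \<Longrightarrow> f i j = 0"
  shows "det1 n f = 0"
proof -
  have "(\<Prod>i\<in>{1..n}. f i (Suc (p (i - 1)))) = 0" if "p permutes {0..<n}" for p
  proof (rule prod_zero)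
    show "\<exists>i\<in>{1..n}. f i (Suc (p (i - 1))) = 0"
      using assms permutes_in_image[OF that, of "i - 1"] by (intro bexI[of _ i]) auto
  qed simp
  then show ?thesis by (simp add: det1_Leibniz)
qed

lemma det1_equal_rows:
  assumes "i \<in> {1..n}" "k \<in> {1..n}" "i \<noteq> k" "\<And>j. j \<in> {1..n} \<Longrightarrow> f i j = f k j"
  shows "det1 n f = 0"
  unfolding det1_def
  by (rule det_identical_rows[of _ n "i - 1" "k - 1"])
     (use assms in \<open>auto intro!: eq_vecI simp: Suc_le_eq\<close>)

text \<open>Since row \<open>i\<close> of \<open>A\<close> is changed by a multiple of the original row \<open>i + 1\<close> of \<open>A\<close>, for all \<open>i\<close>
  simultaneously, the passage from \<open>A\<close> to \<open>B\<close> is multiplication by an upper unitriangular matrix.\<close>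

lemma det1_add_next_row:
  fixes A B :: "nat \<Rightarrow> nat \<Rightarrow> 'a::comm_ring_1"
  assumes AB: "\<And>i j. i \<in> {1..n} \<Longrightarrow> j \<in> {1..n} \<Longrightarrow>
      A i j = B i j + (if i < n then t i * A (Suc i) j else 0)"
  shows "det1 n A = det1 n B"
proof -
  let ?M = "\<lambda>f. mat n n (\<lambda>(i, j). f (Suc i) (Suc j))"
  define U where "U = mat n n (\<lambda>(i, k). if k = i then 1 else if k = Suc i then - t (Suc i) else (0::'a))"
  have B: "?M B = U * ?M A"
  proof (rule eq_matI)
    fix i j assume ij: "i < dim_row (U * ?M A)" "j < dim_col (U * ?M A)"
    then have ij: "i < n" "j < n" by (auto simp: U_def)
    have "(U * ?M A) $$ (i, j) = (\<Sum>k<n. (if k = i then 1 else if k = Suc i then - t (Suc i) else 0) * A (Suc k) (Suc j))"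
      using ij by (simp add: U_def scalar_prod_def lessThan_atLeast0)
    also have "\<dots> = (\<Sum>k<n. (if k = i then A (Suc k) (Suc j) else 0) + (if k = Suc i then - t (Suc i) * A (Suc k) (Suc j) else 0))"
      by (rule sum.cong) auto
    also have "\<dots> = A (Suc i) (Suc j) + (if Suc i < n then - t (Suc i) * A (Suc (Suc i)) (Suc j) else 0)"
      using ij by (simp add: sum.distrib sum.delta')
    also have "\<dots> = B (Suc i) (Suc j)"
      using AB[of "Suc i" "Suc j"] ij by auto
    finally show "?M B $$ (i, j) = (U * ?M A) $$ (i, j)" using ij by simp
  qed (auto simp: U_def)
  have "upper_triangular U" by (auto simp: U_def)
  then have "Determinant.det U = prod_list (diag_mat U)"
    by (rule det_upper_triangular[of _ n]) (simp add: U_def)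
  also have "diag_mat U = map (\<lambda>_. 1) [0..<n]"
    unfolding diag_mat_def by (rule map_cong) (auto simp: U_def)
  also have "prod_list \<dots> = 1" by (simp add: map_replicate_const)
  finally have "Determinant.det U = 1" .
  moreover have "Determinant.det (U * ?M A) = Determinant.det U * Determinant.det (?M A)"
    by (rule det_mult[of _ n]) (auto simp: U_def)
  ultimately show ?thesis unfolding det1_def B by simp
qed

lemma det1_one: "det1 n (\<lambda>i j. if i = j then 1 else 0) = 1"
proof -
  have "mat n n (\<lambda>(i, j). if Suc i = Suc j then 1 else (0::'a)) = 1\<^sub>m n"
    by (rule eq_matI) auto
  then show ?thesis unfolding det1_def by simp
qed

section \<open>The finite identity for rows\<close>

text \<open>With no values available, a Jacobi-Trudi matrix is the 0-1 matrix of the equation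
  \<open>c i - i + j = 0\<close>. It is the identity for the empty shape; otherwise \<open>c 1 > 0\<close> and the first
  row vanishes.\<close>

lemma det1_chain_entry_0:
  fixes c :: "nat \<Rightarrow> int"
  assumes anti: "\<And>i k. 1 \<le> i \<Longrightarrow> i \<le> k \<Longrightarrow> k \<le> n \<Longrightarrow> c k \<le> c i"
    and nonneg: "\<And>i. i \<in> {1..n} \<Longrightarrow> 0 \<le> c i"
  shows "det1 n (\<lambda>i j. chain_entry R w 0 (f j) (c i - int i + int j)) = (if \<forall>i\<in>{1..n}. c i = 0 then 1 else 0)"
proof (cases "\<forall>i\<in>{1..n}. c i = 0")
  case True
  have "det1 n (\<lambda>i j. chain_entry R w 0 (f j) (c i - int i + int j)) = det1 n (\<lambda>i j. if i = j then 1 else 0)"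
    by (rule det1_cong) (use True in \<open>auto simp: chain_entry_0\<close>)
  with True show ?thesis by (simp add: det1_one)
next
  case False
  then obtain i where i: "i \<in> {1..n}" "c i \<noteq> 0" by auto
  then have "0 < c i" using nonneg[of i] by force
  also have "c i \<le> c 1" using anti[of 1 i] i by auto
  finally have "det1 n (\<lambda>i j. chain_entry R w 0 (f j) (c i - int i + int j)) = 0"
    using i by (intro det1_zero_row[of 1]) (auto simp: chain_entry_0)
  with False show ?thesis by simp
qed

abbreviation content_weight :: "(int \<Rightarrow> nat \<Rightarrow> 'a) \<Rightarrow> nat \<times> nat \<Rightarrow> nat \<Rightarrow> 'a" where
  "content_weight w p \<equiv> w (int (snd p) - int (fst p))"

definition row_shape :: "nat \<Rightarrow> (nat \<Rightarrow> nat) \<Rightarrow> (nat \<times> nat) set" where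
  "row_shape r \<kappa> = (SIGMA i:{1..r}. {1..\<kappa> i})"

lemma initial_segment_nat:
  fixes A :: "nat set"
  assumes sub: "A \<subseteq> {1..n}" and down: "\<And>j k. j \<in> A \<Longrightarrow> 1 \<le> k \<Longrightarrow> k < j \<Longrightarrow> k \<in> A"
  shows "A = {1..card A}"
proof (cases "A = {}")
  case False
  have fin: "finite A" using sub finite_subset by blast
  have "A = {1..Max A}"
  proof (intro Set.equalityI subsetI)
    fix x assume "x \<in> A" then show "x \<in> {1..Max A}" using sub fin by auto
  next
    fix x assume "x \<in> {1..Max A}"
    then show "x \<in> A" using down[OF Max_in[OF fin False], of x] Max_in[OF fin False]
      by (cases "x = Max A") auto
  qed
  then show ?thesis by (metis card_atLeastAtMost diff_Suc_1)
qed simp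

lemma antimono_consecutive:
  fixes c :: "nat \<Rightarrow> 'a::order"
  assumes "\<And>i. 1 \<le> i \<Longrightarrow> i < n \<Longrightarrow> c (Suc i) \<le> c i"
  shows "1 \<le> i \<Longrightarrow> i \<le> k \<Longrightarrow> k \<le> n \<Longrightarrow> c k \<le> c i"
proof (induction k)
  case (Suc k)
  then show ?case
    by (cases "i = Suc k") (auto intro: order_trans[OF assms])
qed simp

text \<open>The possible lengths of row \<open>i\<close> after removing a horizontal strip from the shape with row
  lengths \<open>\<kappa>\<close>: the part of row \<open>i\<close> lying above row \<open>i + 1\<close> has to stay. Below the last row there is
  nothing, so that the last row may disappear.\<close>

definition interlacing :: "nat \<Rightarrow> (nat \<Rightarrow> nat) \<Rightarrow> nat \<Rightarrow> nat set" where
  "interlacing r \<kappa> i = {if i < r then \<kappa> (Suc i) else 0..\<kappa> i}"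

text \<open>The row lengths can be chosen independently of each other: the interlacing conditions already imply
  that they decrease weakly.\<close>

lemma bij_betw_strips_row_shape:
  assumes anti: "\<And>i. 1 \<le> i \<Longrightarrow> i < r \<Longrightarrow> \<kappa> (Suc i) \<le> \<kappa> i"
  shows "bij_betw (row_shape r) (Pi\<^sub>E {1..r} (interlacing r \<kappa>)) (strips (row_shape r \<kappa>))"
proof (rule bij_betw_byWitness[where f' = "\<lambda>E. \<lambda>i\<in>{1..r}. card {j. (i, j) \<in> E}"])
  show "\<forall>\<mu>\<in>Pi\<^sub>E {1..r} (interlacing r \<kappa>). (\<lambda>i\<in>{1..r}. card {j. (i, j) \<in> row_shape r \<mu>}) = \<mu>"
  proof
    fix \<mu> assume "\<mu> \<in> Pi\<^sub>E {1..r} (interlacing r \<kappa>)"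
    moreover have "{j. (i, j) \<in> row_shape r \<mu>} = {1..\<mu> i}" if "i \<in> {1..r}" for i
      using that by (auto simp: row_shape_def)
    ultimately show "(\<lambda>i\<in>{1..r}. card {j. (i, j) \<in> row_shape r \<mu>}) = \<mu>"
      by (auto simp: fun_eq_iff PiE_def extensional_def restrict_def)
  qed
  have mem: "(i, j) \<in> E \<longleftrightarrow> i \<in> {1..r} \<and> 1 \<le> j \<and> j \<le> card {j. (i, j) \<in> E}"
    and bnd: "i \<in> {1..r} \<Longrightarrow> card {j. (i, j) \<in> E} \<in> interlacing r \<kappa> i"
    if E: "E \<in> strips (row_shape r \<kappa>)" for E i j
  proof -
    have sub: "E \<subseteq> row_shape r \<kappa>"
      and row: "\<And>i j k. (i, j) \<in> E \<Longrightarrow> (i, k) \<in> row_shape r \<kappa> \<Longrightarrow> k < j \<Longrightarrow> (i, k) \<in> E"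
      and col: "\<And>i j k. (i, k) \<in> row_shape r \<kappa> \<Longrightarrow> (j, k) \<in> row_shape r \<kappa> \<Longrightarrow> i < j \<Longrightarrow> (i, k) \<in> E"
      using E unfolding strips_def by blast+
    have subi: "{j. (i, j) \<in> E} \<subseteq> {1..\<kappa> i}" for i
      using sub by (auto simp: row_shape_def)
    have seg: "{j. (i, j) \<in> E} = {1..card {j. (i, j) \<in> E}}" for i
    proof (rule initial_segment_nat[OF subi])
      fix j k assume *: "j \<in> {j. (i, j) \<in> E}" "1 \<le> k" "k < j"
      then have "(i, k) \<in> row_shape r \<kappa>" using sub by (auto simp: row_shape_def)
      with * row show "k \<in> {j. (i, j) \<in> E}" by blast
    qed
    show "(i, j) \<in> E \<longleftrightarrow> i \<in> {1..r} \<and> 1 \<le> j \<and> j \<le> card {j. (i, j) \<in> E}"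
      using arg_cong[OF seg[of i], of "\<lambda>A. j \<in> A"] sub by (auto simp only: mem_Collect_eq row_shape_def atLeastAtMost_iff mem_Sigma_iff)
    show "card {j. (i, j) \<in> E} \<in> interlacing r \<kappa> i" if i: "i \<in> {1..r}"
    proof -
      have "card {j. (i, j) \<in> E} \<le> \<kappa> i"
        using card_mono[OF _ subi[of i]] by simp
      moreover have "\<kappa> (Suc i) \<le> card {j. (i, j) \<in> E}" if "i < r"
      proof -
        have "{1..\<kappa> (Suc i)} \<subseteq> {j. (i, j) \<in> E}"
        proof
          fix j assume "j \<in> {1..\<kappa> (Suc i)}"
          then show "j \<in> {j. (i, j) \<in> E}"
            using that i anti[of i] col[of i j "Suc i"] by (auto simp: row_shape_def)
        qed
        from card_mono[OF finite_subset[OF subi] this] show ?thesis by simp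
      qed
      ultimately show ?thesis by (auto simp: interlacing_def)
    qed
  qed
  show "\<forall>E\<in>strips (row_shape r \<kappa>). row_shape r (\<lambda>i\<in>{1..r}. card {j. (i, j) \<in> E}) = E"
  proof
    fix E assume E: "E \<in> strips (row_shape r \<kappa>)"
    have "(i, j) \<in> row_shape r (\<lambda>i\<in>{1..r}. card {j. (i, j) \<in> E}) \<longleftrightarrow> (i, j) \<in> E" for i j
      unfolding mem[OF E, of i j] by (auto simp: row_shape_def)
    then show "row_shape r (\<lambda>i\<in>{1..r}. card {j. (i, j) \<in> E}) = E" by auto
  qed
  show "(\<lambda>E. \<lambda>i\<in>{1..r}. card {j. (i, j) \<in> E}) ` strips (row_shape r \<kappa>) \<subseteq> Pi\<^sub>E {1..r} (interlacing r \<kappa>)"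
    using bnd by auto
  show "row_shape r ` Pi\<^sub>E {1..r} (interlacing r \<kappa>) \<subseteq> strips (row_shape r \<kappa>)"
  proof (rule image_subsetI)
    fix \<mu> assume \<mu>: "\<mu> \<in> Pi\<^sub>E {1..r} (interlacing r \<kappa>)"
    have le: "\<mu> i \<le> \<kappa> i" if "i \<in> {1..r}" for i
      using PiE_mem[OF \<mu> that] by (auto simp: interlacing_def)
    have ge: "\<kappa> k \<le> \<mu> i" if "1 \<le> i" "i < k" "k \<le> r" for i k
    proof -
      have "\<kappa> k \<le> \<kappa> (Suc i)" using antimono_consecutive[of r \<kappa> "Suc i" k] anti that by auto
      also have "\<dots> \<le> \<mu> i" using PiE_mem[OF \<mu>, of i] that by (auto simp: interlacing_def)
      finally show ?thesis .
    qed
    show "row_shape r \<mu> \<in> strips (row_shape r \<kappa>)"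
      unfolding strips_def mem_Collect_eq row_shape_def
    proof (intro conjI allI impI)
      show "Sigma {1..r} (\<lambda>i. {1..\<mu> i}) \<subseteq> Sigma {1..r} (\<lambda>i. {1..\<kappa> i})"
        using le by fastforce
    next
      fix i j k
      assume "(i, k) \<in> Sigma {1..r} (\<lambda>i. {1..\<kappa> i})" "(j, k) \<in> Sigma {1..r} (\<lambda>i. {1..\<kappa> i})" "i < j"
      then show "(i, k) \<in> Sigma {1..r} (\<lambda>i. {1..\<mu> i})"
        using ge[of i j] by auto
    qed auto
  qed
qed

text \<open>Iterating the recursion along row \<open>i\<close>, from length \<open>q\<close> down to length \<open>l\<close>. With \<open>q\<close> the length
  of row \<open>i\<close> and \<open>l\<close> the length of row \<open>i + 1\<close>, the sum runs over the lengths allowed by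
  \<open>interlacing\<close>, and the remainder is a multiple of an entry of row \<open>i + 1\<close>, as
  \<open>l - 1 - i = l - (i + 1)\<close>.\<close>

lemma chain_entry_weak_telescope:
  assumes "l \<le> q"
  shows "chain_entry (\<le>) w (Suc N) (\<lambda>k. k - int j) (int q - int i + int j) =
     (\<Sum>k\<in>{l..q}. (\<Prod>u\<in>{k<..q}. w (int u - int i) (Suc N)) * 
         chain_entry (\<le>) w N (\<lambda>k. k - int j) (int k - int i + int j))
     + (\<Prod>u\<in>{l..q}. w (int u - int i) (Suc N)) *
         chain_entry (\<le>) w (Suc N) (\<lambda>k. k - int j) (int l - 1 - int i + int j)"
  using assms
proof (induction q rule: dec_induct)
  case base
  show ?case
    by (subst chain_entry_weak_Suc) (simp add: algebra_simps)
next
  case (step q)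
  have 1: "{k<..Suc q} = insert (Suc q) {k<..q}" if "k \<in> {l..q}" for k
    using that by auto
  have "int (Suc q) - int i + int j - 1 = int q - int i + int j" by simp
  then have "chain_entry (\<le>) w (Suc N) (\<lambda>k. k - int j) (int (Suc q) - int i + int j) =
    chain_entry (\<le>) w N (\<lambda>k. k - int j) (int (Suc q) - int i + int j) + w (int (Suc q) - int i) (Suc N) *
      chain_entry (\<le>) w (Suc N) (\<lambda>k. k - int j) (int q - int i + int j)"
    using chain_entry_weak_Suc[of w N "\<lambda>k. k - int j" "int (Suc q) - int i + int j"] by (simp only:) simp
  also have "\<dots> = chain_entry (\<le>) w N (\<lambda>k. k - int j) (int (Suc q) - int i + int j) 
     + (\<Sum>k\<in>{l..q}. (\<Prod>u\<in>{k<..Suc q}. w (int u - int i) (Suc N)) * 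
         chain_entry (\<le>) w N (\<lambda>k. k - int j) (int k - int i + int j))
     + (\<Prod>u\<in>{l..Suc q}. w (int u - int i) (Suc N)) *
         chain_entry (\<le>) w (Suc N) (\<lambda>k. k - int j) (int l - 1 - int i + int j)"
    unfolding step.IH using step.hyps
    by (simp add: 1 distrib_left sum_distrib_left mult.assoc add.assoc cong: sum.cong_simp)
  finally show ?case
    using step.hyps by (simp add: algebra_simps)
qed

text \<open>Subtracting from each row the multiple of the next row given by the telescoped recursion leaves
  in row \<open>i\<close> a sum over the lengths allowed by \<open>interlacing\<close>. Expanding all rows, the choices of
  summands correspond one-to-one to the shapes in the branching rule, so that there is no
  cancellation.\<close>

theorem bounded_jacobi_trudi_rows:
  fixes w :: "int \<Rightarrow> nat \<Rightarrow> 'a::comm_ring_1"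
  assumes "\<And>i. 1 \<le> i \<Longrightarrow> i < r \<Longrightarrow> \<kappa> (Suc i) \<le> \<kappa> i"
  shows "ssyt_sum (content_weight w) (row_shape r \<kappa>) N =
     det1 r (\<lambda>i j. chain_entry (\<le>) w N (\<lambda>k. k - int j) (int (\<kappa> i) - int i + int j))"
  using assms
proof (induction N arbitrary: \<kappa>)
  case 0
  have "(row_shape r \<kappa> = {}) \<longleftrightarrow> (\<forall>i\<in>{1..r}. int (\<kappa> i) = 0)"
    by (simp add: row_shape_def Sigma_empty_iff) (auto simp: less_Suc_eq)
  with det1_chain_entry_0[of r "\<lambda>i. int (\<kappa> i)" "(\<le>)" w "\<lambda>j k. k - int j"] 0 show ?case
    using antimono_consecutive[of r \<kappa>] by (simp add: ssyt_sum_0)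
next
  case (Suc N)
  let ?K = "interlacing r \<kappa>"
  define x where "x = (\<lambda>i k. \<Prod>u\<in>{k<..\<kappa> i}. w (int u - int i) (Suc N))"
  have fin: "finite (row_shape r \<kappa>)" by (simp add: row_shape_def)
  have "ssyt_sum (content_weight w) (row_shape r \<kappa>) (Suc N) =
    (\<Sum>E\<in>strips (row_shape r \<kappa>). (\<Prod>p\<in>row_shape r \<kappa> - E. content_weight w p (Suc N)) *
        ssyt_sum (content_weight w) E N)"
    by (rule ssyt_sum_Suc[OF fin])
  also have "\<dots> = (\<Sum>\<mu>\<in>Pi\<^sub>E {1..r} ?K. (\<Prod>p\<in>row_shape r \<kappa> - row_shape r \<mu>. content_weight w p (Suc N)) *
        ssyt_sum (content_weight w) (row_shape r \<mu>) N)"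
    by (rule sum.reindex_bij_betw[OF bij_betw_strips_row_shape, symmetric]) (fact Suc.prems)
  also have "\<dots> = (\<Sum>\<mu>\<in>Pi\<^sub>E {1..r} ?K. (\<Prod>i\<in>{1..r}. x i (\<mu> i)) *
      det1 r (\<lambda>i j. chain_entry (\<le>) w N (\<lambda>k. k - int j) (int (\<mu> i) - int i + int j)))"
  proof (intro sum.cong refl arg_cong2[of _ _ _ _ "(*)"])
    fix \<mu> assume \<mu>: "\<mu> \<in> Pi\<^sub>E {1..r} ?K"
    have "row_shape r \<kappa> - row_shape r \<mu> = (SIGMA i:{1..r}. {\<mu> i<..\<kappa> i})"
      by (auto simp: row_shape_def)
    then show "(\<Prod>p\<in>row_shape r \<kappa> - row_shape r \<mu>. content_weight w p (Suc N)) = (\<Prod>i\<in>{1..r}. x i (\<mu> i))"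
      by (simp add: x_def prod.Sigma case_prod_unfold)
    have "\<mu> (Suc i) \<le> \<mu> i" if "1 \<le> i" "i < r" for i
      using PiE_mem[OF \<mu>, of i] PiE_mem[OF \<mu>, of "Suc i"] that by (auto simp: interlacing_def)
    then show "ssyt_sum (content_weight w) (row_shape r \<mu>) N =
        det1 r (\<lambda>i j. chain_entry (\<le>) w N (\<lambda>k. k - int j) (int (\<mu> i) - int i + int j))"
      by (rule Suc.IH)
  qed
  also have "\<dots> = det1 r (\<lambda>i j. \<Sum>k\<in>?K i. x i k * chain_entry (\<le>) w N (\<lambda>k. k - int j) (int k - int i + int j))"
    by (rule det1_expand_rows[symmetric]) (simp add: interlacing_def)
  also have "\<dots> = det1 r (\<lambda>i j. chain_entry (\<le>) w (Suc N) (\<lambda>k. k - int j) (int (\<kappa> i) - int i + int j))"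
  proof (rule det1_add_next_row[where t = "\<lambda>i. \<Prod>u\<in>?K i. w (int u - int i) (Suc N)", symmetric])
    fix i j assume ij: "i \<in> {1..r}" "j \<in> {1..r}"
    define l where "l = (if i < r then \<kappa> (Suc i) else 0)"
    have K: "?K i = {l..\<kappa> i}" and "l \<le> \<kappa> i"
      using Suc.prems[of i] ij by (auto simp: interlacing_def l_def)
    \<comment> \<open>In the last row the remainder has length \<open>j - r - 1 < 0\<close>, hence is 0.\<close>
    moreover have "chain_entry (\<le>) w (Suc N) (\<lambda>k. k - int j) (int l - 1 - int i + int j) =
       (if i < r then chain_entry (\<le>) w (Suc N) (\<lambda>k. k - int j) (int (\<kappa> (Suc i)) - int (Suc i) + int j) else 0)"
      using ij by (auto simp: l_def chain_entry_def algebra_simps)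
    ultimately show "chain_entry (\<le>) w (Suc N) (\<lambda>k. k - int j) (int (\<kappa> i) - int i + int j) =
      (\<Sum>k\<in>?K i. x i k * chain_entry (\<le>) w N (\<lambda>k. k - int j) (int k - int i + int j)) +
      (if i < r then (\<Prod>u\<in>?K i. w (int u - int i) (Suc N)) *
         chain_entry (\<le>) w (Suc N) (\<lambda>k. k - int j) (int (\<kappa> (Suc i)) - int (Suc i) + int j) else 0)"
      using chain_entry_weak_telescope[of l "\<kappa> i" w N j i] by (simp add: x_def)
  qed
  finally show ?case .
qed

section \<open>The finite identity for columns\<close>

text \<open>Column heights are integers: lowering every column by 0 or 1 can produce the height \<open>- 1\<close>, and
  such a choice has to be kept as a (vanishing) summand of the expanded determinant.\<close>

definition col_shape :: "nat \<Rightarrow> (nat \<Rightarrow> int) \<Rightarrow> (nat \<times> nat) set" where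
  "col_shape s c = {(i, j). j \<in> {1..s} \<and> 1 \<le> i \<and> int i \<le> c j}"

definition lowered_columns :: "nat \<Rightarrow> (nat \<Rightarrow> int) \<Rightarrow> (nat \<Rightarrow> int) set" where
  "lowered_columns s c = {\<mu> \<in> (\<Pi>\<^sub>E j\<in>{1..s}. {c j - 1..c j}).
     (\<forall>j. 1 \<le> j \<longrightarrow> j < s \<longrightarrow> \<mu> (Suc j) \<le> \<mu> j) \<and> (\<forall>j\<in>{1..s}. 0 \<le> \<mu> j)}"

lemma finite_col_shape: "finite (col_shape s c)"
proof (rule finite_subset)
  show "col_shape s c \<subseteq> prod.swap ` (SIGMA j:{1..s}. {1..nat (c j)})"
    by (force simp: col_shape_def)
qed simp

text \<open>In contrast to row lengths, lowered column heights are not automatically weakly decreasing; that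
  they are is the closure of the remaining cells under moves to the left.\<close>

lemma bij_betw_strips_col_shape:
  assumes anti: "\<And>j. 1 \<le> j \<Longrightarrow> j < s \<Longrightarrow> c (Suc j) \<le> c j"
    and nonneg: "\<And>j. j \<in> {1..s} \<Longrightarrow> 0 \<le> c j"
  shows "bij_betw (col_shape s) (lowered_columns s c) (strips (col_shape s c))"
proof (rule bij_betw_byWitness[where f' = "\<lambda>E. \<lambda>j\<in>{1..s}. int (card {i. (i, j) \<in> E})"])
  show "\<forall>\<mu>\<in>lowered_columns s c. (\<lambda>j\<in>{1..s}. int (card {i. (i, j) \<in> col_shape s \<mu>})) = \<mu>"
  proof
    fix \<mu> assume \<mu>: "\<mu> \<in> lowered_columns s c"
    then have "\<mu> \<in> (\<Pi>\<^sub>E j\<in>{1..s}. {c j - 1..c j})" by (simp add: lowered_columns_def)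
    moreover have "int (card {i. (i, j) \<in> col_shape s \<mu>}) = \<mu> j" if "j \<in> {1..s}" for j
    proof -
      have "{i. (i, j) \<in> col_shape s \<mu>} = {1..nat (\<mu> j)}"
        using that by (auto simp: col_shape_def)
      then show ?thesis using \<mu> that by (simp add: lowered_columns_def)
    qed
    ultimately show "(\<lambda>j\<in>{1..s}. int (card {i. (i, j) \<in> col_shape s \<mu>})) = \<mu>"
      by (auto simp: fun_eq_iff PiE_def extensional_def restrict_def)
  qed
  have mem: "(i, j) \<in> E \<longleftrightarrow> j \<in> {1..s} \<and> 1 \<le> i \<and> i \<le> card {i. (i, j) \<in> E}"
    and bnd: "(\<lambda>j\<in>{1..s}. int (card {i. (i, j) \<in> E})) \<in> lowered_columns s c"
    if E: "E \<in> strips (col_shape s c)" for E i j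
  proof -
    have sub: "E \<subseteq> col_shape s c"
      and row: "\<And>i j k. (i, j) \<in> E \<Longrightarrow> (i, k) \<in> col_shape s c \<Longrightarrow> k < j \<Longrightarrow> (i, k) \<in> E"
      and col: "\<And>i j k. (i, k) \<in> col_shape s c \<Longrightarrow> (j, k) \<in> col_shape s c \<Longrightarrow> i < j \<Longrightarrow> (i, k) \<in> E"
      using E unfolding strips_def by blast+
    have subj: "{i. (i, j) \<in> E} \<subseteq> {1..nat (c j)}" for j
      using sub by (auto simp: col_shape_def)
    have seg: "{i. (i, j) \<in> E} = {1..card {i. (i, j) \<in> E}}" for j
    proof (rule initial_segment_nat[OF subj])
      fix i k assume *: "i \<in> {i. (i, j) \<in> E}" "1 \<le> k" "k < i"
      then have "(i, j) \<in> col_shape s c" using sub by auto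
      with * have "(k, j) \<in> col_shape s c" by (auto simp: col_shape_def)
      with * \<open>(i, j) \<in> col_shape s c\<close> col show "k \<in> {i. (i, j) \<in> E}" by blast
    qed
    show mem: "(i, j) \<in> E \<longleftrightarrow> j \<in> {1..s} \<and> 1 \<le> i \<and> i \<le> card {i. (i, j) \<in> E}" for i j
      using arg_cong[OF seg[of j], of "\<lambda>A. i \<in> A"] sub
      by (auto simp only: mem_Collect_eq col_shape_def atLeastAtMost_iff case_prod_conv)
    have le: "int (card {i. (i, j) \<in> E}) \<le> c j" if "j \<in> {1..s}" for j
      using card_mono[OF _ subj[of j]] nonneg[OF that] by (simp add: le_nat_iff)
    have ge: "c j - 1 \<le> int (card {i. (i, j) \<in> E})" if "j \<in> {1..s}" for j
    proof -
      have "{1..nat (c j) - 1} \<subseteq> {i. (i, j) \<in> E}"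
      proof
        fix i assume "i \<in> {1..nat (c j) - 1}"
        then show "i \<in> {i. (i, j) \<in> E}"
          using that col[of i j "nat (c j)"] by (auto simp: col_shape_def)
      qed
      from card_mono[OF finite_subset[OF subj] this] show ?thesis by simp
    qed
    have anti': "card {i. (i, Suc j) \<in> E} \<le> card {i. (i, j) \<in> E}" if j: "1 \<le> j" "j < s" for j
    proof (rule card_mono)
      show "finite {i. (i, j) \<in> E}" by (rule finite_subset[OF subj]) simp
      show "{i. (i, Suc j) \<in> E} \<subseteq> {i. (i, j) \<in> E}"
      proof
        fix i assume i: "i \<in> {i. (i, Suc j) \<in> E}"
        then have "(i, j) \<in> col_shape s c"
          using sub j anti[OF j] by (auto simp: col_shape_def)
        with i row show "i \<in> {i. (i, j) \<in> E}" by blast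
      qed
    qed
    show "(\<lambda>j\<in>{1..s}. int (card {i. (i, j) \<in> E})) \<in> lowered_columns s c"
      using le ge anti' by (auto simp: lowered_columns_def)
  qed
  show "\<forall>E\<in>strips (col_shape s c). col_shape s (\<lambda>j\<in>{1..s}. int (card {i. (i, j) \<in> E})) = E"
  proof
    fix E assume E: "E \<in> strips (col_shape s c)"
    have "(i, j) \<in> col_shape s (\<lambda>j\<in>{1..s}. int (card {i. (i, j) \<in> E})) \<longleftrightarrow> (i, j) \<in> E" for i j
      unfolding mem[OF E, of i j] by (auto simp: col_shape_def)
    then show "col_shape s (\<lambda>j\<in>{1..s}. int (card {i. (i, j) \<in> E})) = E" by auto
  qed
  show "(\<lambda>E. \<lambda>j\<in>{1..s}. int (card {i. (i, j) \<in> E})) ` strips (col_shape s c) \<subseteq> lowered_columns s c"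
    using bnd by blast
  show "col_shape s ` lowered_columns s c \<subseteq> strips (col_shape s c)"
  proof (rule image_subsetI)
    fix \<mu> assume \<mu>: "\<mu> \<in> lowered_columns s c"
    then have P: "\<mu> \<in> (\<Pi>\<^sub>E j\<in>{1..s}. {c j - 1..c j})" by (simp add: lowered_columns_def)
    have le: "\<mu> j \<le> c j" and ge: "c j - 1 \<le> \<mu> j" if "j \<in> {1..s}" for j
      using PiE_mem[OF P that] by auto
    have anti\<mu>: "\<mu> k \<le> \<mu> j" if "1 \<le> j" "j \<le> k" "k \<le> s" for j k
      using antimono_consecutive[of s \<mu> j k] \<mu> that by (auto simp: lowered_columns_def)
    show "col_shape s \<mu> \<in> strips (col_shape s c)"
      unfolding strips_def mem_Collect_eq
    proof (intro conjI allI impI)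
      show "col_shape s \<mu> \<subseteq> col_shape s c"
        using le by (force simp: col_shape_def)
    next
      fix i j k
      assume "(i, j) \<in> col_shape s \<mu>" "(i, k) \<in> col_shape s c" "k < j"
      then show "(i, k) \<in> col_shape s \<mu>"
        using anti\<mu>[of k j] by (auto simp: col_shape_def)
    next
      fix i j k
      assume "(i, k) \<in> col_shape s c" "(j, k) \<in> col_shape s c" "i < j"
      then show "(i, k) \<in> col_shape s \<mu>"
        using ge[of k] by (auto simp: col_shape_def)
    qed
  qed
qed

text \<open>The summands of the expansion that do not come from a shape vanish. If the heights increase from
  \<open>j\<close> to \<open>j + 1\<close>, then columns \<open>j\<close> and \<open>j + 1\<close> had equal heights and only the former was lowered,
  so that \<open>\<mu> (j + 1) - (j + 1) = \<mu> j - j\<close> and two rows of the matrix agree. If the heights decrease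
  weakly and one is negative, then so is the last one, and the last row is 0.\<close>

lemma det1_lowered_columns_eq_0:
  assumes anti: "\<And>j. 1 \<le> j \<Longrightarrow> j < s \<Longrightarrow> c (Suc j) \<le> c j"
    and \<mu>: "\<mu> \<in> (\<Pi>\<^sub>E j\<in>{1..s}. {c j - 1..c j}) - lowered_columns s c"
    and c: "\<And>j. j \<in> {1..s} \<Longrightarrow> 0 \<le> c j"
  shows "det1 s (\<lambda>i j. chain_entry R w N (f j) (\<mu> i - int i + int j)) = 0"
proof (cases "\<exists>j. 1 \<le> j \<and> j < s \<and> \<mu> j < \<mu> (Suc j)")
  case True
  then obtain j where j: "1 \<le> j" "j < s" "\<mu> j < \<mu> (Suc j)" by blast
  have "c j - 1 \<le> \<mu> j" "\<mu> (Suc j) \<le> c (Suc j)"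
    using \<mu> PiE_mem[of \<mu> "{1..s}" _ j] PiE_mem[of \<mu> "{1..s}" _ "Suc j"] j by auto
  with anti[of j] j have "\<mu> (Suc j) = \<mu> j + 1" by linarith
  then show ?thesis
    using j by (intro det1_equal_rows[of j s "Suc j"]) auto
next
  case False
  with \<mu> obtain j where j: "j \<in> {1..s}" "\<mu> j < 0"
    by (force simp: lowered_columns_def)
  have "\<mu> s \<le> \<mu> j"
    using antimono_consecutive[of s \<mu> j s] False j by force
  with j show ?thesis
    by (intro det1_zero_row[of s]) (auto simp: chain_entry_def)
qed

text \<open>A strict chain contains the value \<open>N + 1\<close> at most once, so each row of the matrix is a sum of only
  two terms: the column keeps its height or loses its lowest cell. No row operation is needed, but
  the expansion contains summands that do not correspond to shapes.\<close>

theorem bounded_jacobi_trudi_columns: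
  fixes w :: "int \<Rightarrow> nat \<Rightarrow> 'a::comm_ring_1"
  assumes "\<And>j. 1 \<le> j \<Longrightarrow> j < s \<Longrightarrow> c (Suc j) \<le> c j"
    and "\<And>j. j \<in> {1..s} \<Longrightarrow> 0 \<le> c j"
  shows "ssyt_sum (content_weight w) (col_shape s c) N =
     det1 s (\<lambda>i j. chain_entry (<) w N (\<lambda>k. int j - k) (c i - int i + int j))"
  using assms
proof (induction N arbitrary: c)
  case 0
  have "(col_shape s c = {}) \<longleftrightarrow> (\<forall>j\<in>{1..s}. c j = 0)"
  proof
    assume e: "col_shape s c = {}"
    show "\<forall>j\<in>{1..s}. c j = 0"
    proof
      fix j assume j: "j \<in> {1..s}"
      have "(1, j) \<notin> col_shape s c" using e by simp
      with j 0(2)[OF j] show "c j = 0" by (auto simp: col_shape_def)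
    qed
  qed (auto simp: col_shape_def)
  with det1_chain_entry_0[of s c "(<)" w "\<lambda>j k. int j - k"] 0 show ?case
    using antimono_consecutive[of s c] by (simp add: ssyt_sum_0)
next
  case (Suc N)
  note anti = Suc.prems(1) and nonneg = Suc.prems(2)
  let ?P = "\<Pi>\<^sub>E j\<in>{1..s}. {c j - 1..c j}"
  let ?d = "\<lambda>\<mu>. det1 s (\<lambda>i j. chain_entry (<) w N (\<lambda>k. int j - k) (\<mu> i - int i + int j))"
  define x where "x = (\<lambda>j k. if k = c j then 1 else w (int j - c j) (Suc N))"
  have "ssyt_sum (content_weight w) (col_shape s c) (Suc N) =
    (\<Sum>E\<in>strips (col_shape s c). (\<Prod>p\<in>col_shape s c - E. content_weight w p (Suc N)) *
        ssyt_sum (content_weight w) E N)"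
    by (rule ssyt_sum_Suc[OF finite_col_shape])
  also have "\<dots> = (\<Sum>\<mu>\<in>lowered_columns s c.
        (\<Prod>p\<in>col_shape s c - col_shape s \<mu>. content_weight w p (Suc N)) *
        ssyt_sum (content_weight w) (col_shape s \<mu>) N)"
    by (rule sum.reindex_bij_betw[OF bij_betw_strips_col_shape, symmetric]) (fact anti nonneg)+
  also have "\<dots> = (\<Sum>\<mu>\<in>lowered_columns s c. (\<Prod>i\<in>{1..s}. x i (\<mu> i)) * ?d \<mu>)"
  proof (intro sum.cong refl arg_cong2[of _ _ _ _ "(*)"])
    fix \<mu> assume \<mu>: "\<mu> \<in> lowered_columns s c"
    then have P: "\<mu> \<in> ?P" by (simp add: lowered_columns_def)
    define U where "U = (\<lambda>j. {i. 1 \<le> i \<and> \<mu> j < int i \<and> int i \<le> c j})"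
    have "U j \<subseteq> {1..nat (c j)}" for j by (auto simp: U_def)
    then have fin: "finite (U j)" for j by (rule finite_subset) simp
    have "col_shape s c - col_shape s \<mu> = prod.swap ` (SIGMA j:{1..s}. U j)"
      by (auto simp: col_shape_def U_def image_iff)
    then have "(\<Prod>p\<in>col_shape s c - col_shape s \<mu>. content_weight w p (Suc N)) =
        (\<Prod>j\<in>{1..s}. \<Prod>i\<in>U j. w (int j - int i) (Suc N))"
      by (simp add: prod.reindex prod.Sigma fin case_prod_unfold)
    also have "\<dots> = (\<Prod>j\<in>{1..s}. x j (\<mu> j))"
    proof (rule prod.cong[OF refl])
      fix j assume j: "j \<in> {1..s}"
      have "c j - 1 \<le> \<mu> j" "\<mu> j \<le> c j" "0 \<le> \<mu> j"
        using PiE_mem[OF P j] \<mu> j by (auto simp: lowered_columns_def)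
      then consider "\<mu> j = c j" | "\<mu> j = c j - 1" "1 \<le> c j" by linarith
      then show "(\<Prod>i\<in>U j. w (int j - int i) (Suc N)) = x j (\<mu> j)"
      proof cases
        case 1
        then have "U j = {}" by (auto simp: U_def)
        with 1 show ?thesis by (simp add: x_def)
      next
        case 2
        then have "U j = {nat (c j)}" by (auto simp: U_def)
        with 2 show ?thesis by (simp add: x_def)
      qed
    qed
    finally show "(\<Prod>p\<in>col_shape s c - col_shape s \<mu>. content_weight w p (Suc N)) =
        (\<Prod>i\<in>{1..s}. x i (\<mu> i))" .
    show "ssyt_sum (content_weight w) (col_shape s \<mu>) N = ?d \<mu>"
      by (rule Suc.IH) (use \<mu> in \<open>auto simp: lowered_columns_def\<close>)
  qed
  also have "\<dots> = (\<Sum>\<mu>\<in>?P. (\<Prod>i\<in>{1..s}. x i (\<mu> i)) * ?d \<mu>)"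
  proof (rule sum.mono_neutral_left)
    show "finite ?P" by (auto intro: finite_PiE)
    show "lowered_columns s c \<subseteq> ?P" by (auto simp: lowered_columns_def)
    show "\<forall>\<mu>\<in>?P - lowered_columns s c. (\<Prod>i\<in>{1..s}. x i (\<mu> i)) * ?d \<mu> = 0"
    proof
      fix \<mu> assume "\<mu> \<in> ?P - lowered_columns s c"
      then have "?d \<mu> = 0" by (intro det1_lowered_columns_eq_0[of s c]) (auto intro: anti nonneg)
      then show "(\<Prod>i\<in>{1..s}. x i (\<mu> i)) * ?d \<mu> = 0" by simp
    qed
  qed
  also have "\<dots> = det1 s (\<lambda>i j. \<Sum>k\<in>{c i - 1..c i}. x i k * chain_entry (<) w N (\<lambda>k. int j - k) (k - int i + int j))"
    by (rule det1_expand_rows[symmetric]) simp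
  also have "\<dots> = det1 s (\<lambda>i j. chain_entry (<) w (Suc N) (\<lambda>k. int j - k) (c i - int i + int j))"
  proof (rule det1_cong)
    fix i j
    have "{c i - 1..c i} = {c i, c i - 1}" by auto
    moreover have "chain_entry (<) w N (\<lambda>k. int j - k) (c i - int i + int j - 1) =
        chain_entry (<) w N (\<lambda>k. int j - k) (c i - 1 - int i + int j)"
      by (rule arg_cong) simp
    ultimately show "(\<Sum>k\<in>{c i - 1..c i}. x i k * chain_entry (<) w N (\<lambda>k. int j - k) (k - int i + int j)) =
        chain_entry (<) w (Suc N) (\<lambda>k. int j - k) (c i - int i + int j)"
      by (subst chain_entry_strict_Suc) (simp add: x_def)
  qed
  finally show ?case .
qed

section \<open>Absolute convergence and limits\<close>

lemma sum_tendsto_infsum: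
  fixes f :: "'b \<Rightarrow> 'a::{comm_monoid_add, t2_space}"
  assumes f: "f summable_on (\<Union>N. B N)" and inc: "incseq B" and fin: "\<And>N::nat. finite (B N)"
  shows "(\<lambda>N. sum f (B N)) \<longlonglongrightarrow> infsum f (\<Union>N. B N)"
proof -
  have "filterlim B (finite_subsets_at_top (\<Union>N. B N)) sequentially"
    unfolding filterlim_finite_subsets_at_top
  proof (intro allI impI)
    fix X assume "finite X \<and> X \<subseteq> (\<Union>N. B N)"
    then have "finite X" "X \<subseteq> (\<Union>N. B N)" by simp_all
    then have "\<exists>N. X \<subseteq> B N"
    proof (induction X rule: finite_induct)
      case (insert x X)
      then obtain N M where "X \<subseteq> B N" "x \<in> B M" by auto
      then have "insert x X \<subseteq> B (max N M)"
        using incseqD[OF inc, of N "max N M"] incseqD[OF inc, of M "max N M"] by auto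
      then show ?case by blast
    qed simp
    then obtain N where N: "X \<subseteq> B N" by blast
    show "\<forall>\<^sub>F y in sequentially. finite (B y) \<and> X \<subseteq> B y \<and> B y \<subseteq> (\<Union>N. B N)"
      using eventually_ge_at_top[of N]
    proof eventually_elim
      case (elim M)
      then show ?case using incseqD[OF inc elim] N fin by blast
    qed
  qed
  from filterlim_compose[OF infsum_tendsto[OF f] this] show ?thesis .
qed

lemma summable_on_fillings:
  fixes \<epsilon> :: real
  assumes D: "finite D" and \<epsilon>: "0 < \<epsilon>"
  shows "(\<lambda>t. \<Prod>p\<in>D. real (t p) powr - (1 + \<epsilon>)) summable_on (D \<rightarrow>\<^sub>E {0<..})"
proof (rule nonneg_bdd_above_summable_on)
  let ?g = "\<lambda>m::nat. real m powr - (1 + \<epsilon>)"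
  have sg: "summable ?g" using \<epsilon> by (simp add: summable_real_powr_iff)
  show "bdd_above (sum (\<lambda>t. \<Prod>p\<in>D. ?g (t p)) ` {F. F \<subseteq> D \<rightarrow>\<^sub>E {0<..} \<and> finite F})"
  proof (rule bdd_aboveI2)
    fix F assume "F \<in> {F. F \<subseteq> D \<rightarrow>\<^sub>E {0::nat<..} \<and> finite F}"
    then have F: "F \<subseteq> D \<rightarrow>\<^sub>E {0<..}" "finite F" by auto
    have "finite (\<Union>t\<in>F. t ` D)" using F D by auto
    then have "\<exists>N. \<forall>m\<in>(\<Union>t\<in>F. t ` D). m \<le> N"
      by (rule finite_nat_set_iff_bounded_le[THEN iffD1])
    then obtain N where N: "\<forall>m\<in>(\<Union>t\<in>F. t ` D). m \<le> N" ..
    have sub: "F \<subseteq> D \<rightarrow>\<^sub>E {1..N}"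
    proof
      fix t assume t: "t \<in> F"
      then have tD: "t \<in> D \<rightarrow>\<^sub>E {0<..}" using F by blast
      show "t \<in> D \<rightarrow>\<^sub>E {1..N}"
      proof (rule PiE_I)
        fix p assume "p \<in> D"
        then show "t p \<in> {1..N}" using PiE_mem[OF tD, of p] N t by auto
      qed (rule PiE_arb[OF tD])
    qed
    have "(\<Sum>t\<in>F. \<Prod>p\<in>D. ?g (t p)) \<le> (\<Sum>t\<in>D \<rightarrow>\<^sub>E {1..N}. \<Prod>p\<in>D. ?g (t p))"
      by (rule sum_mono2[OF _ sub]) (auto intro!: finite_PiE D prod_nonneg)
    also have "\<dots> = (\<Prod>p\<in>D. \<Sum>m\<in>{1..N}. ?g m)"
      by (rule prod_sum_PiE[symmetric]) (auto simp: D)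
    also have "\<dots> \<le> (\<Prod>p\<in>D. suminf ?g)"
      by (intro prod_mono conjI sum_nonneg sum_le_suminf sg) auto
    finally show "(\<Sum>t\<in>F. \<Prod>p\<in>D. ?g (t p)) \<le> (\<Prod>p\<in>D. suminf ?g)" .
  qed
qed (auto intro: prod_nonneg)

text \<open>The excess \<open>\<delta>\<close> of the exponent at a cell with maximal entry can be distributed evenly over all
  cells: since no entry exceeds \<open>t b\<close>, the factor \<open>t b powr - \<delta>\<close> is at most the product of all
  \<open>t p powr - (\<delta> / card D)\<close>. The bound is a term of a product of convergent Dirichlet series.\<close>

lemma norm_filling_le:
  fixes \<sigma> :: "'s \<Rightarrow> complex" and t :: "'s \<Rightarrow> nat"
  assumes D: "finite D" and pos: "\<And>p. p \<in> D \<Longrightarrow> 0 < t p"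
    and re: "\<And>p. p \<in> D \<Longrightarrow> 1 \<le> Re (\<sigma> p)"
    and b: "b \<in> D" "1 + \<delta> \<le> Re (\<sigma> b)" "\<And>p. p \<in> D \<Longrightarrow> t p \<le> t b" and \<delta>: "0 < \<delta>"
  shows "norm (\<Prod>p\<in>D. of_nat (t p) powr - \<sigma> p) \<le> (\<Prod>p\<in>D. real (t p) powr - (1 + \<delta> / card D))"
proof -
  define L where "L = (\<lambda>p. ln (real (t p)))"
  have L0: "0 \<le> L p" if "p \<in> D" for p using pos[OF that] by (simp add: L_def Suc_le_eq)
  have Lb: "L p \<le> L b" if "p \<in> D" for p using pos[OF that] b(3)[OF that] by (simp add: L_def)
  have c: "0 < card D" using D b by (auto simp: card_gt_0_iff)
  have "(\<Sum>p\<in>D. (\<delta> / card D) * L p) \<le> (\<Sum>p\<in>D. (\<delta> / card D) * L b)"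
    by (intro sum_mono mult_left_mono Lb) (use \<delta> in auto)
  also have "\<dots> = \<delta> * L b" using c by simp
  also have "\<dots> \<le> (Re (\<sigma> b) - 1) * L b"
    using b L0[of b] by (intro mult_right_mono) auto
  also have "\<dots> \<le> (\<Sum>p\<in>D. (Re (\<sigma> p) - 1) * L p)"
    by (rule member_le_sum) (use b re L0 D in auto)
  finally have "(\<Sum>p\<in>D. - Re (\<sigma> p) * L p) \<le> (\<Sum>p\<in>D. - (1 + \<delta> / card D) * L p)"
    by (simp add: algebra_simps sum.distrib sum_subtractf sum_negf)
  then have "exp (\<Sum>p\<in>D. - Re (\<sigma> p) * L p) \<le> exp (\<Sum>p\<in>D. - (1 + \<delta> / card D) * L p)" by simp
  also have "exp (\<Sum>p\<in>D. - (1 + \<delta> / card D) * L p) = (\<Prod>p\<in>D. real (t p) powr - (1 + \<delta> / card D))"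
    unfolding exp_sum[OF D] using pos by (intro prod.cong) (auto simp: powr_def L_def)
  also have "exp (\<Sum>p\<in>D. - Re (\<sigma> p) * L p) = norm (\<Prod>p\<in>D. of_nat (t p) powr - \<sigma> p)"
    unfolding exp_sum[OF D] prod_norm[symmetric] using pos
    by (intro prod.cong) (auto simp: norm_powr_real_powr powr_def L_def)
  finally show ?thesis .
qed

text \<open>Absolute convergence for a family \<open>S\<close> of fillings whose maximum is always attained in \<open>C\<close>, a
  set of cells with exponents of real part above 1. For chains \<open>C\<close> is the last position, for tableaux
  it is the set of corners.\<close>

lemma zeta_terms_summable_on:
  fixes \<sigma> :: "'s \<Rightarrow> complex"
  assumes D: "finite D" and S: "S \<subseteq> D \<rightarrow>\<^sub>E {0::nat<..}"
    and re: "\<And>p. p \<in> D \<Longrightarrow> 1 \<le> Re (\<sigma> p)"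
    and C: "C \<subseteq> D" "\<And>p. p \<in> C \<Longrightarrow> 1 < Re (\<sigma> p)"
    and max: "\<And>t. t \<in> S \<Longrightarrow> D \<noteq> {} \<Longrightarrow> \<exists>b\<in>C. \<forall>p\<in>D. t p \<le> t b"
  shows "(\<lambda>t. \<Prod>p\<in>D. of_nat (t p) powr - \<sigma> p) summable_on S"
proof (cases "D = {}")
  case True
  then have "finite S" using S by (simp add: finite_subset)
  then show ?thesis by (rule summable_on_finite)
next
  case False
  have "\<exists>\<delta>>0. \<forall>p\<in>C. 1 + \<delta> \<le> Re (\<sigma> p)"
  proof (cases "C = {}")
    case False
    let ?M = "Min ((\<lambda>p. Re (\<sigma> p) - 1) ` C)"
    have fC: "finite C" using C(1) D by (rule finite_subset)
    then have "0 < ?M" using False C(2) by simp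
    moreover have "?M \<le> Re (\<sigma> p) - 1" if "p \<in> C" for p
      using that fC by (intro Min_le) auto
    ultimately show ?thesis by (intro exI[of _ ?M]) force
  qed (auto intro: exI[of _ 1])
  then obtain \<delta> where \<delta>: "0 < \<delta>" "\<And>p. p \<in> C \<Longrightarrow> 1 + \<delta> \<le> Re (\<sigma> p)" by blast
  let ?g = "\<lambda>t. \<Prod>p\<in>D. real (t p) powr - (1 + \<delta> / card D)"
  have "0 < \<delta> / card D" using \<delta> D False by (simp add: card_gt_0_iff)
  from summable_on_fillings[OF D this]
  have g: "?g summable_on S" by (rule summable_on_subset_banach) (rule S)
  have "norm (\<Prod>p\<in>D. of_nat (t p) powr - \<sigma> p) \<le> ?g t" if t: "t \<in> S" for t
  proof -
    obtain b where b: "b \<in> C" "\<forall>p\<in>D. t p \<le> t b" using max[OF t False] by blast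
    have "t \<in> D \<rightarrow>\<^sub>E {0<..}" using S t by blast
    then have "0 < t p" if "p \<in> D" for p using that by (auto simp: PiE_iff)
    then show ?thesis
      using b C(1) by (intro norm_filling_le[OF D _ re]) (auto simp: \<delta>)
  qed
  then have "(\<lambda>t. norm (\<Prod>p\<in>D. of_nat (t p) powr - \<sigma> p)) summable_on S"
    by (intro summable_on_comparison_test[OF g]) auto
  then show ?thesis by (rule abs_summable_summable)
qed

text \<open>Lists are turned into functions on their index set, where the convergence criterion for fillings
  applies. For \<open>R\<close> the weak or strict order, the limit is the multiple zeta star or multiple zeta
  value.\<close>

lemma chain_sum_tendsto:
  fixes a :: "int \<Rightarrow> complex"
  assumes R: "\<And>x y. R x y \<Longrightarrow> x \<le> y"
    and re: "\<And>c. c \<in> set cs \<Longrightarrow> 1 \<le> Re (a c)" and last: "cs \<noteq> [] \<Longrightarrow> 1 < Re (a (last cs))"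
  shows "(\<lambda>N. chain_sum R (\<lambda>c m. of_nat m powr - a c) N cs) \<longlonglongrightarrow>
    (\<Sum>\<^sub>\<infinity>m | length m = length (map a cs) \<and> (\<forall>x\<in>set m. 0 < x) \<and> sorted_wrt R m.
       \<Prod>i<length (map a cs). of_nat (m ! i :: nat) powr - (map a cs ! i))"
proof -
  let ?n = "length cs"
  let ?f = "\<lambda>m::nat list. \<Prod>i<?n. of_nat (m ! i) powr - a (cs ! i)"
  let ?A = "{m. length m = length (map a cs) \<and> (\<forall>x\<in>set m. 0 < x) \<and> sorted_wrt R m}"
  have A: "?A = (\<Union>N. chains R ?n N)"
  proof (intro Set.equalityI subsetI)
    fix m assume m: "m \<in> ?A"
    have "finite (set m)" by simp
    then have "\<exists>N. \<forall>x\<in>set m. x \<le> N"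
      by (rule finite_nat_set_iff_bounded_le[THEN iffD1])
    then obtain N where "\<forall>x\<in>set m. x \<le> N" ..
    with m have "m \<in> chains R ?n N" by (auto simp: chains_def Suc_le_eq)
    then show "m \<in> (\<Union>N. chains R ?n N)" by blast
  qed (force simp: chains_def)
  define h where "h = (\<lambda>m::nat list. \<lambda>i\<in>{..<?n}. m ! i)"
  have inj: "inj_on h ?A"
  proof (rule inj_onI)
    fix m m' assume mm: "m \<in> ?A" "m' \<in> ?A" and eq: "h m = h m'"
    show "m = m'"
    proof (rule nth_equalityI)
      fix i assume "i < length m"
      then show "m ! i = m' ! i" using fun_cong[OF eq, of i] mm by (simp add: h_def)
    qed (use mm in simp)
  qed
  have "(\<lambda>t. \<Prod>i\<in>{..<?n}. of_nat (t i) powr - a (cs ! i)) summable_on h ` ?A"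
    \<comment> \<open>The intersection is the last index, or empty if there is none.\<close>
  proof (rule zeta_terms_summable_on[where C = "{..<?n} \<inter> {?n - 1}"])
    show "h ` ?A \<subseteq> {..<?n} \<rightarrow>\<^sub>E {0<..}"
      by (rule image_subsetI) (auto simp: h_def PiE_iff)
    show "1 < Re (a (cs ! i))" if "i \<in> {..<?n} \<inter> {?n - 1}" for i
    proof -
      have "cs \<noteq> []" "i = ?n - 1" using that by auto
      with last[OF this(1)] show ?thesis by (simp add: last_conv_nth)
    qed
    fix t assume t: "t \<in> h ` ?A" "{..<?n} \<noteq> {}"
    then obtain m where m: "t = h m" "m \<in> ?A" by blast
    have le: "t i \<le> t (?n - 1)" if "i < ?n" for i
    proof (cases "i = ?n - 1")
      case False
      with that have "i < ?n - 1" and n: "?n - 1 < ?n" by simp_all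
      then have "R (m ! i) (m ! (?n - 1))" using m(2) by (intro sorted_wrt_nth_less[of R m]) auto
      from R[OF this] that n show ?thesis by (simp add: m(1) h_def)
    qed simp
    show "\<exists>b\<in>{..<?n} \<inter> {?n - 1}. \<forall>p\<in>{..<?n}. t p \<le> t b"
      by (rule bexI[of _ "?n - 1"]) (use t(2) le in auto)
  qed (auto simp: re)
  then have "((\<lambda>t. \<Prod>i\<in>{..<?n}. of_nat (t i) powr - a (cs ! i)) \<circ> h) summable_on ?A"
    by (simp only: summable_on_reindex[OF inj])
  also have "(\<lambda>t. \<Prod>i\<in>{..<?n}. of_nat (t i) powr - a (cs ! i)) \<circ> h = ?f"
    by (auto simp: h_def fun_eq_iff intro!: prod.cong)
  finally have "?f summable_on (\<Union>N. chains R ?n N)" unfolding A .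
  then have "(\<lambda>N. sum ?f (chains R ?n N)) \<longlonglongrightarrow> infsum ?f (\<Union>N. chains R ?n N)"
    by (rule sum_tendsto_infsum[OF _ _ finite_chains]) (auto simp: chains_def incseq_def)
  moreover have "(\<Prod>i<length (map a cs). of_nat (m ! i) powr - (map a cs ! i)) = ?f m" for m :: "nat list"
    by (auto intro!: prod.cong)
  ultimately show ?thesis
    unfolding A by (simp only: chain_sum_def)
qed

lemma chain_entry_tendsto:
  fixes a :: "int \<Rightarrow> complex"
  assumes R: "\<And>x y. R x y \<Longrightarrow> x \<le> y"
    and re: "\<And>k. 1 \<le> k \<Longrightarrow> k \<le> n \<Longrightarrow> 1 \<le> Re (a (f k))" and last: "1 \<le> n \<Longrightarrow> 1 < Re (a (f n))"
  shows "(\<lambda>N. chain_entry R (\<lambda>c m. of_nat m powr - a c) N f n) \<longlonglongrightarrow>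
    (if n < 0 then 0 else if n = 0 then 1 else
       (\<Sum>\<^sub>\<infinity>m | length m = length (map (\<lambda>k. a (f k)) [1..n]) \<and> (\<forall>x\<in>set m. 0 < x) \<and> sorted_wrt R m.
        \<Prod>i<length (map (\<lambda>k. a (f k)) [1..n]). of_nat (m ! i :: nat) powr - (map (\<lambda>k. a (f k)) [1..n] ! i)))"
proof (cases "1 \<le> n")
  case True
  then have "List.last (map f [1..n]) = f n" by (simp add: upto_rec2)
  then have "(\<lambda>N. chain_sum R (\<lambda>c m. of_nat m powr - a c) N (map f [1..n])) \<longlonglongrightarrow>
    (\<Sum>\<^sub>\<infinity>m | length m = length (map a (map f [1..n])) \<and> (\<forall>x\<in>set m. 0 < x) \<and> sorted_wrt R m.
       \<Prod>i<length (map a (map f [1..n])). of_nat (m ! i :: nat) powr - (map a (map f [1..n]) ! i))"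
    using True re last by (intro chain_sum_tendsto R) auto
  with True show ?thesis
    by (simp add: chain_entry_def)
next
  case False
  then show ?thesis by (cases "n = 0") (simp_all add: chain_entry_def chain_sum_Nil)
qed

lemma det1_tendsto:
  fixes f :: "'i \<Rightarrow> nat \<Rightarrow> nat \<Rightarrow> 'a::{real_normed_algebra, comm_ring_1}"
  assumes "\<And>i j. i \<in> {1..n} \<Longrightarrow> j \<in> {1..n} \<Longrightarrow> ((\<lambda>N. f N i j) \<longlongrightarrow> g i j) F"
  shows "((\<lambda>N. det1 n (f N)) \<longlongrightarrow> det1 n g) F"
  unfolding det1_Leibniz
proof (intro tendsto_sum tendsto_mult tendsto_const tendsto_prod assms)
  fix p i assume "p \<in> {p. p permutes {0..<n}}" "i \<in> {1..n}"
  then show "Suc (p (i - 1)) \<in> {1..n}"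
    using permutes_in_image[of p "{0..<n}" "i - 1"] by (auto simp: Suc_le_eq)
qed

section \<open>Partitions and Schur multiple zeta values\<close>

lemma part_antimono:
  assumes "is_partition lam" "1 \<le> i" "i \<le> k"
  shows "part lam k \<le> part lam i"
proof (cases "k \<le> length lam \<and> i \<noteq> k")
  case True
  then have "lam ! (k - 1) \<le> lam ! (i - 1)"
    using assms by (intro sorted_wrt_nth_less[of "(\<ge>)" lam]) (auto simp: is_partition_def)
  with True assms show ?thesis by (simp add: part_def)
qed (auto simp: part_def)

lemma part_pos:
  assumes "is_partition lam" "i \<in> {1..length lam}"
  shows "0 < part lam i"
  using assms by (auto simp: part_def is_partition_def)

lemma young_diagram_row_shape: "young_diagram lam = row_shape (length lam) (part lam)"
  by (auto simp: young_diagram_def row_shape_def)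

lemma finite_young_diagram: "finite (young_diagram lam)"
  by (simp add: young_diagram_row_shape row_shape_def)

lemma le_conj_part_iff:
  assumes "is_partition lam" "1 \<le> i" "1 \<le> j"
  shows "i \<le> conj_part lam j \<longleftrightarrow> i \<le> length lam \<and> j \<le> part lam i"
proof -
  let ?A = "{i. 1 \<le> i \<and> i \<le> length lam \<and> j \<le> part lam i}"
  have "?A = {1..card ?A}"
  proof (rule initial_segment_nat)
    show "?A \<subseteq> {1..length lam}" by auto
    fix i k assume "i \<in> ?A" "1 \<le> k" "k < i"
    with part_antimono[OF assms(1), of k i] show "k \<in> ?A" by auto
  qed
  then have "i \<in> ?A \<longleftrightarrow> i \<in> {1..conj_part lam j}"
    unfolding conj_part_def by (rule arg_cong)
  with assms show ?thesis by auto
qed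

lemma young_diagram_col_shape:
  assumes "is_partition lam"
  shows "young_diagram lam = col_shape (part lam 1) (\<lambda>j. int (conj_part lam j))"
proof -
  have "(i, j) \<in> young_diagram lam \<longleftrightarrow> (i, j) \<in> col_shape (part lam 1) (\<lambda>j. int (conj_part lam j))" for i j
    using le_conj_part_iff[OF assms, of i j] part_antimono[OF assms, of 1 i]
    by (auto simp: young_diagram_def col_shape_def)
  then show ?thesis by auto
qed

text \<open>All contents occur in the first column or the first row. Hence every exponent \<open>a c\<close> in one of the
  two matrices is an entry of \<open>s\<close>.\<close>

lemma content_in_young_diagram:
  assumes "is_partition lam" "- int (length lam) < c" "c < int (part lam 1)"
  shows "\<exists>i j. (i, j) \<in> young_diagram lam \<and> int j - int i = c"
proof (cases "c \<le> 0")
  case True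
  then have "(nat (1 - c), 1) \<in> young_diagram lam"
    using assms part_pos[of lam "nat (1 - c)"] by (auto simp: young_diagram_def nat_le_iff Suc_le_eq)
  with True show ?thesis by (intro exI[of _ "nat (1 - c)"] exI[of _ 1]) auto
next
  case False
  have "lam \<noteq> []" using False assms by (auto simp: part_def)
  with False assms have "(1, nat (1 + c)) \<in> young_diagram lam"
    by (auto simp: young_diagram_def nat_le_iff Suc_le_eq)
  with False show ?thesis by (intro exI[of _ 1] exI[of _ "nat (1 + c)"]) auto
qed

lemma incseq_bounded_ssyt: "incseq (bounded_ssyt D)"
proof (rule incseq_SucI, rule subsetI)
  fix N t assume t: "t \<in> bounded_ssyt D N"
  moreover from t have "t \<in> D \<rightarrow>\<^sub>E {1..Suc N}"
    by (auto simp: bounded_ssyt_def PiE_iff le_SucI)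
  ultimately show "t \<in> bounded_ssyt D (Suc N)" unfolding bounded_ssyt_def by blast
qed

lemma SSYT_eq_Union: "SSYT lam = (\<Union>N. bounded_ssyt (young_diagram lam) N)"
proof (intro Set.equalityI subsetI)
  fix t assume t: "t \<in> SSYT lam"
  have "finite (t ` young_diagram lam)" by (simp add: finite_young_diagram)
  then have "\<exists>N. \<forall>x\<in>t ` young_diagram lam. x \<le> N"
    by (rule finite_nat_set_iff_bounded_le[THEN iffD1])
  then obtain N where "\<forall>x\<in>t ` young_diagram lam. x \<le> N" ..
  with t have "t \<in> bounded_ssyt (young_diagram lam) N"
    by (auto simp: SSYT_def tableaux_def bounded_ssyt_def PiE_iff Suc_le_eq)
  then show "t \<in> (\<Union>N. bounded_ssyt (young_diagram lam) N)" by blast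
next
  fix t assume "t \<in> (\<Union>N. bounded_ssyt (young_diagram lam) N)"
  then obtain N where "t \<in> bounded_ssyt (young_diagram lam) N" by blast
  then show "t \<in> SSYT lam"
    by (auto simp: SSYT_def tableaux_def bounded_ssyt_def PiE_iff Suc_le_eq)
qed

text \<open>Among the cells with maximal entry, one farthest to the south-east is a corner: the cell below it
  would have a larger entry, and the cell to its right would be a maximal cell farther out.\<close>

lemma SSYT_max_at_corner:
  assumes t: "t \<in> SSYT lam" and ne: "young_diagram lam \<noteq> {}"
  shows "\<exists>b\<in>corners lam. \<forall>p\<in>young_diagram lam. t p \<le> t b"
proof -
  let ?D = "young_diagram lam"
  define m where "m = Max (t ` ?D)"
  define A where "A = {p \<in> ?D. t p = m}"
  have le: "t p \<le> m" if "p \<in> ?D" for p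
    using that by (simp add: m_def finite_young_diagram)
  have "m \<in> t ` ?D" unfolding m_def by (rule Max_in) (auto simp: finite_young_diagram ne)
  then have A: "finite A" "A \<noteq> {}" by (auto simp: A_def finite_young_diagram)
  let ?g = "\<lambda>p. fst p + snd p"
  have "Max (?g ` A) \<in> ?g ` A" using A by (intro Max_in) auto
  then obtain b where b: "b \<in> A" "Max (?g ` A) = ?g b" by blast
  have bmax: "?g p \<le> ?g b" if "p \<in> A" for p
    unfolding b(2)[symmetric] using that A by (intro Max_ge) auto
  obtain i j where ij: "b = (i, j)" by (cases b)
  have bD: "(i, j) \<in> ?D" "t (i, j) = m" using b by (auto simp: A_def ij)
  have "(i + 1, j) \<notin> ?D"
  proof
    assume "(i + 1, j) \<in> ?D"
    moreover from this have "t (i, j) < t (i + 1, j)"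
      using t bD by (auto simp: SSYT_def)
    ultimately show False using le[of "(i + 1, j)"] bD by simp
  qed
  moreover have "(i, j + 1) \<notin> ?D"
  proof
    assume *: "(i, j + 1) \<in> ?D"
    then have "t (i, j) \<le> t (i, j + 1)"
      using t bD by (auto simp: SSYT_def)
    with * le[of "(i, j + 1)"] bD have "(i, j + 1) \<in> A" by (auto simp: A_def)
    from bmax[OF this] show False by (simp add: ij)
  qed
  ultimately have "b \<in> corners lam" using bD by (simp add: corners_def ij)
  with le bD show ?thesis by (intro bexI[of _ b]) (auto simp: ij)
qed

lemma W_Re_ge_1: "s \<in> W lam \<Longrightarrow> p \<in> young_diagram lam \<Longrightarrow> 1 \<le> Re (s p)"
  by (cases "p \<in> corners lam") (auto simp: W_def intro: less_imp_le)

lemma ssyt_sum_tendsto_schur_mzeta: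
  assumes s: "s \<in> W lam"
    and a: "\<And>i j. (i, j) \<in> young_diagram lam \<Longrightarrow> a (int j - int i) = s (i, j)"
  shows "(\<lambda>N. ssyt_sum (content_weight (\<lambda>c m. of_nat m powr - a c)) (young_diagram lam) N)
           \<longlonglongrightarrow> schur_mzeta lam s"
proof -
  let ?D = "young_diagram lam"
  let ?f = "\<lambda>t::nat \<times> nat \<Rightarrow> nat. \<Prod>p\<in>?D. of_nat (t p) powr - s p"
  have "?f summable_on SSYT lam"
  proof (rule zeta_terms_summable_on[where C = "corners lam"])
    show "SSYT lam \<subseteq> ?D \<rightarrow>\<^sub>E {0<..}" by (auto simp: SSYT_def tableaux_def)
    show "corners lam \<subseteq> ?D" by (auto simp: corners_def)
  qed (use s W_Re_ge_1[OF s] SSYT_max_at_corner in \<open>auto simp: finite_young_diagram W_def\<close>)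
  then have "(\<lambda>N. sum ?f (bounded_ssyt ?D N)) \<longlonglongrightarrow> infsum ?f (SSYT lam)"
    unfolding SSYT_eq_Union
    by (rule sum_tendsto_infsum[OF _ incseq_bounded_ssyt finite_bounded_ssyt[OF finite_young_diagram]])
  moreover have "ssyt_sum (content_weight (\<lambda>c m. of_nat m powr - a c)) ?D N = sum ?f (bounded_ssyt ?D N)" for N
    unfolding ssyt_sum_def by (intro sum.cong prod.cong) (auto simp: a)
  ultimately show ?thesis by (simp add: schur_mzeta_def)
qed

lemma Re_ge_1_in_content_range:
  assumes lam: "is_partition lam" and s: "s \<in> W lam"
    and a: "\<And>i j. (i, j) \<in> young_diagram lam \<Longrightarrow> a (int j - int i) = s (i, j)"
    and c: "- int (length lam) < c" "c < int (part lam 1)"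
  shows "1 \<le> Re (a c)"
  using content_in_young_diagram[OF lam c] a W_Re_ge_1[OF s] by metis

text \<open>All entries in row \<open>i\<close> of the matrix end with the exponent of the last cell of row \<open>i\<close> of the
  diagram, so the hypothesis on row ends makes each entry a convergent series.\<close>

theorem schur_mzeta_jacobi_trudi:
  assumes lam: "is_partition lam" and s: "s \<in> W lam"
    and a: "\<And>i j. (i, j) \<in> young_diagram lam \<Longrightarrow> a (int j - int i) = s (i, j)"
    and ends: "\<forall>i\<in>{1..length lam}. Re (s (i, part lam i)) > 1"
  shows "schur_mzeta lam s = det1 (length lam) (jacobi_trudi_entry lam a)"
proof -
  let ?w = "\<lambda>c m. of_nat m powr - a c"
  let ?r = "length lam"
  have "(\<lambda>N. chain_entry (\<le>) ?w N (\<lambda>k. k - int j) (int (part lam i) - int i + int j))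
      \<longlonglongrightarrow> jacobi_trudi_entry lam a i j" if ij: "i \<in> {1..?r}" "j \<in> {1..?r}" for i j
  proof -
    define n where "n = int (part lam i) - int i + int j"
    have "(i, part lam i) \<in> young_diagram lam"
      using ij part_pos[OF lam ij(1)] by (auto simp: young_diagram_def)
    from a[OF this] have last: "1 < Re (a (n - int j))"
      using ends ij by (simp add: n_def)
    have re': "1 \<le> Re (a (k - int j))" if "1 \<le> k" "k \<le> n" for k
      using that ij part_antimono[OF lam, of 1 i] by (intro Re_ge_1_in_content_range[OF lam s a]) (auto simp: n_def)
    have "jacobi_trudi_entry lam a i j = (if n < 0 then 0 else if n = 0 then 1
        else mzeta_star (map (\<lambda>k. a (k - int j)) [1..n]))"
      by (simp add: jacobi_trudi_entry_def Let_def n_def algebra_simps)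
    then show ?thesis
      using chain_entry_tendsto[of "(\<le>)" n a "\<lambda>k. k - int j"] re' last
      unfolding n_def[symmetric] mzeta_star_def by simp
  qed
  then have "(\<lambda>N. det1 ?r (\<lambda>i j. chain_entry (\<le>) ?w N (\<lambda>k. k - int j) (int (part lam i) - int i + int j)))
      \<longlonglongrightarrow> det1 ?r (jacobi_trudi_entry lam a)"
    by (rule det1_tendsto)
  moreover have "ssyt_sum (content_weight ?w) (young_diagram lam) N =
      det1 ?r (\<lambda>i j. chain_entry (\<le>) ?w N (\<lambda>k. k - int j) (int (part lam i) - int i + int j))" for N
    unfolding young_diagram_row_shape
    by (rule bounded_jacobi_trudi_rows) (auto intro: part_antimono[OF lam])
  ultimately show "schur_mzeta lam s = det1 ?r (jacobi_trudi_entry lam a)"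
    using LIMSEQ_unique[OF ssyt_sum_tendsto_schur_mzeta[OF s a]] by simp
qed

theorem schur_mzeta_dual_jacobi_trudi:
  assumes lam: "is_partition lam" and s: "s \<in> W lam"
    and a: "\<And>i j. (i, j) \<in> young_diagram lam \<Longrightarrow> a (int j - int i) = s (i, j)"
    and ends: "\<forall>i\<in>{1..part lam 1}. Re (s (conj_part lam i, i)) > 1"
  shows "schur_mzeta lam s = det1 (part lam 1) (dual_jacobi_trudi_entry lam a)"
proof -
  let ?w = "\<lambda>c m. of_nat m powr - a c"
  let ?s = "part lam 1"
  have "(\<lambda>N. chain_entry (<) ?w N (\<lambda>k. int j - k) (int (conj_part lam i) - int i + int j))
      \<longlonglongrightarrow> dual_jacobi_trudi_entry lam a i j" if ij: "i \<in> {1..?s}" "j \<in> {1..?s}" for i j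
  proof -
    define n where "n = int (conj_part lam i) - int i + int j"
    have "1 \<le> length lam" using ij by (auto simp: part_def split: if_splits)
    then have c1: "1 \<le> conj_part lam i"
      using le_conj_part_iff[OF lam, of 1 i] ij by auto
    then have c2: "conj_part lam i \<le> length lam" "i \<le> part lam (conj_part lam i)"
      using le_conj_part_iff[OF lam, of "conj_part lam i" i] ij by auto
    then have "(conj_part lam i, i) \<in> young_diagram lam"
      using ij c1 by (auto simp: young_diagram_def)
    from a[OF this] have last: "1 < Re (a (int j - n))"
      using ends ij by (simp add: n_def)
    have re': "1 \<le> Re (a (int j - k))" if "1 \<le> k" "k \<le> n" for k
      using that ij c2 by (intro Re_ge_1_in_content_range[OF lam s a]) (auto simp: n_def)
    have "dual_jacobi_trudi_entry lam a i j = (if n < 0 then 0 else if n = 0 then 1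
        else mzeta (map (\<lambda>k. a (int j - k)) [1..n]))"
      by (simp add: dual_jacobi_trudi_entry_def Let_def n_def)
    then show ?thesis
      using chain_entry_tendsto[of "(<)" n a "\<lambda>k. int j - k"] re' last
      unfolding n_def[symmetric] mzeta_def by simp
  qed
  then have "(\<lambda>N. det1 ?s (\<lambda>i j. chain_entry (<) ?w N (\<lambda>k. int j - k) (int (conj_part lam i) - int i + int j)))
      \<longlonglongrightarrow> det1 ?s (dual_jacobi_trudi_entry lam a)"
    by (rule det1_tendsto)
  moreover have "ssyt_sum (content_weight ?w) (young_diagram lam) N =
      det1 ?s (\<lambda>i j. chain_entry (<) ?w N (\<lambda>k. int j - k) (int (conj_part lam i) - int i + int j))" for N
    unfolding young_diagram_col_shape[OF lam]
  proof (rule bounded_jacobi_trudi_columns)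
    fix j :: nat assume "1 \<le> j"
    show "int (conj_part lam (Suc j)) \<le> int (conj_part lam j)"
      unfolding conj_part_def by (intro of_nat_mono card_mono) (auto intro: finite_subset[of _ "{1..length lam}"])
  qed simp
  ultimately show "schur_mzeta lam s = det1 ?s (dual_jacobi_trudi_entry lam a)"
    using LIMSEQ_unique[OF ssyt_sum_tendsto_schur_mzeta[OF s a]] by simp
qed

theorem theorem1p1:
  fixes lam :: "nat list" and s :: "nat \<times> nat \<Rightarrow> complex" and a :: "int \<Rightarrow> complex"
  assumes "is_partition lam"
    and "s \<in> W_diag lam"
    and "\<And>i j. (i, j) \<in> young_diagram lam \<Longrightarrow> a (int j - int i) = s (i, j)"
  shows "((\<forall>i\<in>{1..length lam}. Re (s (i, part lam i)) > 1) \<longrightarrow>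
           schur_mzeta lam s =
             Determinant.det (mat (length lam) (length lam)
               (\<lambda>(i, j). jacobi_trudi_entry lam a (i + 1) (j + 1)))) \<and>
         ((\<forall>i\<in>{1..part lam 1}. Re (s (conj_part lam i, i)) > 1) \<longrightarrow>
           schur_mzeta lam s =
             Determinant.det (mat (part lam 1) (part lam 1)
               (\<lambda>(i, j). dual_jacobi_trudi_entry lam a (i + 1) (j + 1))))"
proof -
  have s: "s \<in> W lam" using assms(2) by (simp add: W_diag_def)
  show ?thesis
    using schur_mzeta_jacobi_trudi[OF assms(1) s assms(3)]
      schur_mzeta_dual_jacobi_trudi[OF assms(1) s assms(3)]
    by (simp add: det1_def)
qed

end
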